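(* Let $\Lambda = \{\lambda_{1}, \lambda_{2}, \dots\}\subset \mathbb{Z}^{+}$ be an infinite set with $1\le \lambda_{1} < \lambda_{2} < \dots$ and let $A = \{a_{1}, a_{2}, \dots\}\subset \mathbb{Z}^{+}$ be an infinite set with $1\le a_{1} < a_{2} < \dots$. Then the following are equivalent: (a) for every $n\in \mathbb{Z}^{+}$ there exist a unique positive integer $k_n$ and unique $k_{n}$-tuples of positive integers $(i_{1,n}, \dots ,i_{k_{n},n})$ and $(j_{1,n}, \dots ,j_{k_{n},n})$ with $1 \le j_{1,n} < j_{2,n} < \dots < j_{k_{n},n}$ such that \[ n = \sum_{h=1}^{k_{n}}\lambda_{j_{h,n}}a_{i_{h,n}} \] (that is, exactly one such triple consisting of $k_n$ and the two tuples exists); (b) there exist an integer $\lambda \ge 2$ and an infinite sequence of integers $u_{1}, v_{1}, u_{2}, v_{2}, \dots \ge 2$ such that \[ \Lambda = \Lambda_{\lambda}(u_{1}, v_{1}, u_{2}, v_{2}, \dots) \quad\text{and}\quad A = A_{\lambda}(u_{1}, v_{1}, u_{2}, v_{2}, \dots)\setminus \{0\}. \]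
   Context: $\mathbb{N}$ is the set of nonnegative integers and $\mathbb{Z}^{+}$ the set of positive integers. For positive integers $u_1,v_1,u_2,v_2,\dots$ put $U_i=u_1u_2\cdots u_i$, $V_i=v_1v_2\cdots v_i$ (with $U_0=V_0=1$). For $k\ge 1$ define \[ S(u_{1}, v_{1}, \dots ,u_{k-1}, v_{k-1}, u_{k}) = \Big\{\sum_{h=0}^{k-1} i_h U_hV_h: 0\le i_{h} < u_{h+1},\ h = 0,1, \dots ,k-1\Big\}, \] \[ T(u_{1}, v_{1}, \dots ,u_{k}, v_{k}) = \Big\{\sum_{h=0}^{k-1} j_h U_{h+1}V_h: 0\le j_{h} < v_{h+1},\ h = 0,1, \dots ,k-1\Big\}, \] where all $i_h,j_h$ are integers, and for infinite sequences \[ S(u_{1}, v_{1}, u_{2}, v_{2}, \dots) = \bigcup_{k=1}^{\infty}S(u_{1}, v_{1}, \dots ,u_{k-1}, v_{k-1}, u_{k}),\qquad T(u_{1}, v_{1}, u_{2}, v_{2}, \dots) = \bigcup_{k=1}^{\infty}T(u_{1}, v_{1}, \dots ,u_{k}, v_{k}). \] For an integer $\lambda\ge 2$ define \[ \Lambda_{\lambda}(u_{1}, v_{1}, u_{2}, v_{2}, \dots) = \{\lambda^{s}: s\in S(u_{1}, v_{1}, u_{2}, v_{2}, \dots)\}, \] \[ A_{\lambda}(u_{1}, v_{1}, u_{2}, v_{2}, \dots) = \Big\{\sum_{t\in T(u_{1}, v_{1}, u_{2}, v_{2}, \dots)}\delta_{t}\lambda^{t}: 0\le \delta_{t} < \lambda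 \Big\}, \] where the $\delta_t$ are integers, only finitely many of which are nonzero. *)

theory Defs
  imports Main
begin

text \<open>
  All integers of the statement are nonnegative, so they are rendered as \<^typ>\<open>nat\<close>.
  Sequences are functions on \<^typ>\<open>nat\<close> indexed from 1; their value at 0 is irrelevant.
\<close>

text \<open>The partial products, used for both \<open>U\<^sub>i\<close> and \<open>V\<^sub>i\<close>; the empty product gives \<open>U\<^sub>0 = V\<^sub>0 = 1\<close>.\<close>

definition partial_prod :: "(nat \<Rightarrow> nat) \<Rightarrow> nat \<Rightarrow> nat" where
  "partial_prod u i = (\<Prod>j=1..i. u j)"

definition S_fin :: "(nat \<Rightarrow> nat) \<Rightarrow> (nat \<Rightarrow> nat) \<Rightarrow> nat \<Rightarrow> nat set" where
  "S_fin u v k =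
     {(\<Sum>h<k. i h * partial_prod u h * partial_prod v h) | i. \<forall>h<k. i h < u (h + 1)}"

definition T_fin :: "(nat \<Rightarrow> nat) \<Rightarrow> (nat \<Rightarrow> nat) \<Rightarrow> nat \<Rightarrow> nat set" where
  "T_fin u v k =
     {(\<Sum>h<k. j h * partial_prod u (h + 1) * partial_prod v h) | j. \<forall>h<k. j h < v (h + 1)}"

definition S_inf :: "(nat \<Rightarrow> nat) \<Rightarrow> (nat \<Rightarrow> nat) \<Rightarrow> nat set" where
  "S_inf u v = (\<Union>k\<in>{1..}. S_fin u v k)"

definition T_inf :: "(nat \<Rightarrow> nat) \<Rightarrow> (nat \<Rightarrow> nat) \<Rightarrow> nat set" where
  "T_inf u v = (\<Union>k\<in>{1..}. T_fin u v k)"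

definition Lambda_set :: "nat \<Rightarrow> (nat \<Rightarrow> nat) \<Rightarrow> (nat \<Rightarrow> nat) \<Rightarrow> nat set" where
  "Lambda_set b u v = {b ^ s | s. s \<in> S_inf u v}"

text \<open>
  The sum over the infinite set \<open>T\<close> has only finitely many nonzero terms; it is taken over the
  support of \<open>\<delta>\<close>, since \<^const>\<open>sum\<close> is 0 on infinite index sets.
\<close>

definition A_set :: "nat \<Rightarrow> (nat \<Rightarrow> nat) \<Rightarrow> (nat \<Rightarrow> nat) \<Rightarrow> nat set" where
  "A_set b u v =
     {(\<Sum>t\<in>{t \<in> T_inf u v. \<delta> t \<noteq> 0}. \<delta> t * b ^ t) | \<delta>.
        (\<forall>t\<in>T_inf u v. \<delta> t < b) \<and> finite {t \<in> T_inf u v. \<delta> t \<noteq> 0}}"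

text \<open>
  The \<open>k\<close>-tuples \<open>(i\<^sub>1, \<dots>, i\<^sub>k)\<close> and \<open>(j\<^sub>1, \<dots>, j\<^sub>k)\<close> are lists of length \<open>k\<close>, whose \<open>h\<close>-th
  entry is at list position \<open>h - 1\<close>.
\<close>

definition is_representation ::
  "(nat \<Rightarrow> nat) \<Rightarrow> (nat \<Rightarrow> nat) \<Rightarrow> nat \<Rightarrow> nat \<Rightarrow> nat list \<Rightarrow> nat list \<Rightarrow> bool" where
  "is_representation lam a n k is js \<longleftrightarrow>
     k \<ge> 1 \<and> length is = k \<and> length js = k \<and>
     (\<forall>i\<in>set is. i \<ge> 1) \<and> (\<forall>j\<in>set js. j \<ge> 1) \<and> sorted_wrt (<) js \<and>
     n = (\<Sum>h=1..k. lam (js ! (h - 1)) * a (is ! (h - 1)))"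

end

theory Submission
  imports Defs
begin

text \<open>
  A representation of \<open>n\<close> is a finitely supported function from the weights \<open>\<Lambda>\<close> to \<open>A \<union> {0}\<close>.
  Let \<open>b\<close> be the least weight greater than 1, \<open>S = {s. b\<^sup>s \<in> \<Lambda>}\<close> and \<open>T = {t. b\<^sup>t \<in> A}\<close>.
  Unique representability forces the sums \<open>s + t\<close> with \<open>s \<in> S\<close>, \<open>t \<in> T\<close> to be distinct, so sums
  of multiples \<open>b\<^sup>s x\<close>, where the digits of \<open>x\<close> to base \<open>b\<close> sit at positions in \<open>T\<close>, involve no carries.
  Hence, by strong induction on \<open>n\<close>, every weight is a power of \<open>b\<close>, and \<open>n \<in> A \<union> {0}\<close>
  iff the digits of \<open>n\<close> sit at positions in \<open>T\<close>; moreover every natural number is uniquely \<open>s + t\<close>.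
  By de Bruijn's argument, if \<open>1 \<in> S\<close> and \<open>g\<close> is the least positive element of \<open>T\<close>, then
  \<open>S = {0, \<dots>, g - 1} + g S'\<close> and \<open>T = g T'\<close>, and \<open>(T', S')\<close> is a pair of the same kind;
  the successive values of \<open>g\<close> are \<open>u\<^sub>1, v\<^sub>1, u\<^sub>2, v\<^sub>2, \<dots>\<close>.
\<close>

subsection \<open>Digits\<close>

definition digit :: "nat \<Rightarrow> nat \<Rightarrow> nat \<Rightarrow> nat" where
  "digit b n e = n div b ^ e mod b"

definition digits_in :: "nat \<Rightarrow> nat set \<Rightarrow> nat set" where
  "digits_in b T = {n. \<forall>e. digit b n e \<noteq> 0 \<longrightarrow> e \<in> T}"

lemma digit_zero [simp]: "digit b 0 e = 0"
  by (simp add: digit_def)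

lemma digit_0_right: "digit b n 0 = n mod b"
  by (simp add: digit_def)

lemma digit_Suc: "digit b n (Suc e) = digit b (n div b) e"
  by (simp add: digit_def div_mult2_eq)

lemma digit_less: "0 < b \<Longrightarrow> digit b n e < b"
  by (simp add: digit_def)

lemma digit_div_power: "digit b (n div b ^ k) e = digit b n (k + e)"
  by (simp add: digit_def div_mult2_eq power_add)

lemma digit_power_mult:
  assumes "0 < b"
  shows "digit b (b ^ k * x) e = (if k \<le> e then digit b x (e - k) else 0)"
proof (cases "k \<le> e")
  case True
  then have "b ^ e = b ^ k * b ^ (e - k)"
    by (simp flip: power_add)
  then show ?thesis
    using True assms by (simp add: digit_def div_mult2_eq)
next
  case False
  then have "b ^ k * x = b ^ e * (b * (b ^ (k - e - 1) * x))"
    by (simp flip: power_add power_Suc mult.assoc)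
  then have "b ^ k * x div b ^ e = b * (b ^ (k - e - 1) * x)"
    using assms by (simp only: nonzero_mult_div_cancel_left power_eq_0_iff) simp
  then show ?thesis
    using False by (simp only: digit_def mod_mult_self1_is_0 if_False)
qed

lemma digit_of_digit: "c < b \<Longrightarrow> digit b c e = (if e = 0 then c else 0)"
  by (cases e) (simp_all add: digit_0_right digit_Suc)

lemma digit_eq_0: "n < b ^ e \<Longrightarrow> digit b n e = 0"
  by (simp add: digit_def)

text \<open>Division by \<open>b\<close> shifts the digits by one place, so strong induction on
  \<open>m + n\<close> treats the quotients; position 0 gives the remainders.\<close>

lemma digit_eqI:
  assumes "2 \<le> b" "\<And>e. digit b m e = digit b n e"
  shows "m = n"
  using assms(2)
proof (induction "m + n" arbitrary: m n rule: less_induct)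
  case less
  show ?case
  proof (cases "m + n = 0")
    case False
    have "m div b + n div b < m + n"
    proof (cases "m = 0")
      case True
      then show ?thesis using False assms(1) by simp
    next
      case False
      then have "m div b < m" using assms(1) by simp
      then show ?thesis using div_le_dividend[of n b] by linarith
    qed
    moreover have "\<And>e. digit b (m div b) e = digit b (n div b) e"
      using less.prems[of "Suc _"] by (simp add: digit_Suc)
    ultimately have "m div b = n div b"
      using less.hyps by blast
    moreover have "m mod b = n mod b"
      using less.prems[of 0] by (simp add: digit_0_right)
    ultimately show ?thesis
      by (metis mult_div_mod_eq)
  qed simp
qed

lemma digit_nonzero_ex:
  assumes "2 \<le> b" "n \<noteq> 0"
  obtains e where "digit b n e \<noteq> 0"
  using digit_eqI[OF assms(1), of n 0] assms(2) by auto

lemma less_power_digits: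
  assumes "2 \<le> b" "\<And>e. N \<le> e \<Longrightarrow> digit b n e = 0"
  shows "n < b ^ N"
proof -
  have "n div b ^ N = 0"
    by (rule digit_eqI[OF assms(1)]) (simp add: digit_div_power assms(2))
  then show ?thesis
    using assms(1) by (simp add: div_eq_0_iff)
qed

lemma digit_nonzero_bound:
  assumes "digit b n e \<noteq> 0"
  shows "b ^ e \<le> n"
  using assms digit_eq_0 by (meson not_le)

lemma digit_nonzero_le:
  assumes "2 \<le> b" "digit b n e \<noteq> 0"
  shows "e \<le> n"
proof -
  have "e < 2 ^ e" by (rule less_exp)
  also have "\<dots> \<le> b ^ e" using assms(1) by (simp add: power_mono)
  also have "\<dots> \<le> n" using assms(2) by (rule digit_nonzero_bound)
  finally show ?thesis by simp
qed

text \<open>With at most one nonzero digit per position no carry ever arises. The hypothesis passes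
  to the quotients by \<open>b\<close>, hence the induction on \<open>e\<close> with
  \<open>x\<close> and \<open>y\<close> arbitrary.\<close>

lemma digit_add:
  assumes "0 < b" "\<And>e. digit b x e = 0 \<or> digit b y e = 0"
  shows "digit b (x + y) e = digit b x e + digit b y e"
  using assms(2)
proof (induction e arbitrary: x y)
  have nocarry: "x mod b = 0 \<or> y mod b = 0" if "\<And>e. digit b x e = 0 \<or> digit b y e = 0" for x y
    using that[of 0] by (simp add: digit_0_right)
  {
    case 0
    then have "x mod b = 0 \<or> y mod b = 0" by (rule nocarry)
    moreover have "(x + y) mod b = (x mod b + y mod b) mod b"
      by (simp add: mod_add_eq)
    ultimately show ?case by (auto simp: digit_0_right)
  next
    case (Suc e)
    have "x mod b = 0 \<or> y mod b = 0" using Suc.prems by (rule nocarry)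
    then have "(x + y) div b = x div b + y div b"
      using div_plus_div_distrib_dvd_left[of b x y] div_plus_div_distrib_dvd_right[of b y x]
      by (auto simp: dvd_eq_mod_eq_0)
    moreover have "\<And>e. digit b (x div b) e = 0 \<or> digit b (y div b) e = 0"
      using Suc.prems[of "Suc _"] by (simp add: digit_Suc)
    ultimately show ?case
      using Suc.IH by (simp add: digit_Suc)
  }
qed

text \<open>Each position is occupied by at most one summand, so \<open>digit_add\<close> applies
  whenever a further summand joins the partial sum.\<close>

lemma digit_sum:
  assumes "0 < b" "finite F"
    and "\<And>s s' e. s \<in> F \<Longrightarrow> s' \<in> F \<Longrightarrow> digit b (X s) e \<noteq> 0 \<Longrightarrow> digit b (X s') e \<noteq> 0 \<Longrightarrow> s = s'"
  shows "digit b (\<Sum>s\<in>F. X s) e = (\<Sum>s\<in>F. digit b (X s) e)"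
  using assms(2,3)
proof (induction F arbitrary: e rule: finite_induct)
  case (insert s F)
  have IH: "digit b (\<Sum>s\<in>F. X s) e = (\<Sum>s\<in>F. digit b (X s) e)" for e
    using insert.IH insert.prems by blast
  have "digit b (X s) e = 0 \<or> digit b (\<Sum>s\<in>F. X s) e = 0" for e
  proof (cases "digit b (X s) e = 0")
    case False
    have "digit b (X s') e = 0" if "s' \<in> F" for s'
      using insert.prems[of s s' e] insert.hyps(2) that False by auto
    then show ?thesis by (simp add: IH)
  qed simp
  then show ?case
    using insert.hyps by (simp add: digit_add[OF assms(1)] IH)
qed simp

lemma digit_expansion:
  assumes "0 < b" "finite F" "\<And>t. t \<in> F \<Longrightarrow> d t < b"
  shows "digit b (\<Sum>t\<in>F. d t * b ^ t) e = (if e \<in> F then d e else 0)"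
proof -
  have single: "digit b (d t * b ^ t) e = (if e = t then d t else 0)" if "t \<in> F" for t e
    using assms(1) assms(3)[OF that]
    by (simp add: mult.commute[of "d t"] digit_power_mult digit_of_digit)
  have "digit b (\<Sum>t\<in>F. d t * b ^ t) e = (\<Sum>t\<in>F. digit b (d t * b ^ t) e)"
    using assms(1,2) single by (intro digit_sum) (auto split: if_splits)
  also have "\<dots> = (\<Sum>t\<in>F. if e = t then d t else 0)"
    using single by (intro sum.cong) auto
  finally show ?thesis using assms(2) by simp
qed

lemma digit_power: "2 \<le> b \<Longrightarrow> digit b (b ^ k) e = (if e = k then 1 else 0)"
  using digit_expansion[of b "{k}" "\<lambda>_. 1" e] by simp

lemma finite_digits: "2 \<le> b \<Longrightarrow> finite {e. digit b n e \<noteq> 0}"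
  by (rule finite_subset[of _ "{..n}"]) (auto dest: digit_nonzero_le)

lemma sum_digits:
  assumes "2 \<le> b"
  shows "(\<Sum>e | digit b n e \<noteq> 0. digit b n e * b ^ e) = n"
proof (rule digit_eqI[OF assms])
  fix e
  have "digit b (\<Sum>e | digit b n e \<noteq> 0. digit b n e * b ^ e) e
      = (if e \<in> {e. digit b n e \<noteq> 0} then digit b n e else 0)"
    using assms finite_digits by (intro digit_expansion) (simp_all add: digit_less)
  then show "digit b (\<Sum>e | digit b n e \<noteq> 0. digit b n e * b ^ e) e = digit b n e"
    by simp
qed

text \<open>Trades the choice of coefficients for a condition on the number itself: coefficients
  below \<open>b\<close> can only be its digits.\<close>

lemma A_set_eq_digits_in:
  assumes "2 \<le> b"
  shows "A_set b u v = digits_in b (T_inf u v)"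
proof (intro equalityI subsetI)
  fix x assume "x \<in> A_set b u v"
  then obtain d where d: "\<forall>t\<in>T_inf u v. d t < b" "finite {t \<in> T_inf u v. d t \<noteq> 0}"
    and x: "x = (\<Sum>t\<in>{t \<in> T_inf u v. d t \<noteq> 0}. d t * b ^ t)"
    unfolding A_set_def by blast
  have "digit b x e = (if e \<in> {t \<in> T_inf u v. d t \<noteq> 0} then d e else 0)" for e
    unfolding x using assms d by (intro digit_expansion) simp_all
  then show "x \<in> digits_in b (T_inf u v)"
    by (simp add: digits_in_def)
next
  fix x assume "x \<in> digits_in b (T_inf u v)"
  then have "{t \<in> T_inf u v. digit b x t \<noteq> 0} = {t. digit b x t \<noteq> 0}"
    by (auto simp: digits_in_def)
  then show "x \<in> A_set b u v"
    unfolding A_set_def using assms sum_digits[OF assms, of x] finite_digits[OF assms, of x]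
    by (intro CollectI exI[of _ "digit b x"]) (simp add: digit_less)
qed

subsection \<open>Weighted representations\<close>

text \<open>Encodes a pair of tuples as one function: \<open>f l\<close> is the coefficient attached
  to the weight \<open>l\<close>, and the value 0 means that \<open>l\<close> does not occur.
  Uniqueness of the tuples becomes equality of functions.\<close>

definition weighted_rep :: "nat set \<Rightarrow> nat set \<Rightarrow> nat \<Rightarrow> (nat \<Rightarrow> nat) \<Rightarrow> bool" where
  "weighted_rep L B n f \<longleftrightarrow>
     finite {l. f l \<noteq> 0} \<and> {l. f l \<noteq> 0} \<subseteq> L \<and> range f \<subseteq> B \<and> n = (\<Sum>l | f l \<noteq> 0. l * f l)"

definition sums_unique :: "nat set \<Rightarrow> nat set \<Rightarrow> bool" where
  "sums_unique S T \<longleftrightarrow>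
     (\<forall>s\<in>S. \<forall>s'\<in>S. \<forall>t\<in>T. \<forall>t'\<in>T. s + t = s' + t' \<longrightarrow> s = s' \<and> t = t')"

definition complementing :: "nat set \<Rightarrow> nat set \<Rightarrow> bool" where
  "complementing S T \<longleftrightarrow> sums_unique S T \<and> (\<forall>n. \<exists>s\<in>S. \<exists>t\<in>T. n = s + t)"

lemma sums_uniqueD:
  "sums_unique S T \<Longrightarrow> s + t = s' + t' \<Longrightarrow> s \<in> S \<Longrightarrow> s' \<in> S \<Longrightarrow> t \<in> T \<Longrightarrow> t' \<in> T \<Longrightarrow> s = s' \<and> t = t'"
  by (simp add: sums_unique_def)

lemma digits_inD: "n \<in> digits_in b T \<Longrightarrow> digit b n e \<noteq> 0 \<Longrightarrow> e \<in> T"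
  by (auto simp: digits_in_def)

lemma zero_in_digits_in [simp]: "0 \<in> digits_in b T"
  by (simp add: digits_in_def)

lemma power_in_digits_in: "2 \<le> b \<Longrightarrow> b ^ t \<in> digits_in b T \<longleftrightarrow> t \<in> T"
  by (auto simp: digits_in_def digit_power)

lemma finite_digits_in:
  assumes "2 \<le> b" "finite T"
  shows "finite (digits_in b T)"
proof -
  obtain N where N: "\<forall>t\<in>T. t < N"
    using assms(2) unfolding finite_nat_set_iff_bounded ..
  have "digits_in b T \<subseteq> {..<b ^ N}"
  proof
    fix n assume n: "n \<in> digits_in b T"
    have "n < b ^ N"
    proof (rule less_power_digits[OF assms(1)])
      fix e assume "N \<le> e"
      then have "e \<notin> T" using N leD by blast
      then show "digit b n e = 0" using digits_inD[OF n] by blast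
    qed
    then show "n \<in> {..<b ^ N}" by simp
  qed
  then show ?thesis by (rule finite_subset) simp
qed

text \<open>Multiplication by the powers \<open>b ^ s\<close> moves the digits to disjoint positions, so no carries occur.\<close>

lemma digit_shifted_sum:
  assumes "2 \<le> b" "sums_unique S T" "finite F" "F \<subseteq> S" "x ` F \<subseteq> digits_in b T"
  shows "digit b (\<Sum>s\<in>F. b ^ s * x s) e = (\<Sum>s\<in>F. digit b (b ^ s * x s) e)"
proof (rule digit_sum)
  fix s s' e assume *: "s \<in> F" "s' \<in> F" "digit b (b ^ s * x s) e \<noteq> 0" "digit b (b ^ s' * x s') e \<noteq> 0"
  have "k \<le> e \<and> e - k \<in> T" if "k \<in> F" "digit b (b ^ k * x k) e \<noteq> 0" for k
  proof -
    have "x k \<in> digits_in b T" using assms(5) that(1) by blast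
    moreover have "k \<le> e" "digit b (x k) (e - k) \<noteq> 0"
      using assms(1) that(2) by (simp_all add: digit_power_mult split: if_splits)
    ultimately show ?thesis by (blast dest: digits_inD)
  qed
  then have "s \<le> e" "e - s \<in> T" "s' \<le> e" "e - s' \<in> T"
    using * by blast+
  moreover have "s \<in> S" "s' \<in> S" using *(1,2) assms(4) by blast+
  ultimately show "s = s'"
    using sums_uniqueD[OF assms(2), of s "e - s" s' "e - s'"] by simp
qed (use assms(1,3) in simp_all)

text \<open>The decomposition of the position \<open>s + t\<close> is unique, so only the summand
  with index \<open>s\<close> can reach it. This recovers each \<open>x s\<close> from the
  sum.\<close>

lemma digit_shifted_sum_add:
  assumes "2 \<le> b" "sums_unique S T" "finite F" "F \<subseteq> S" "x ` F \<subseteq> digits_in b T"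
    and "s \<in> S" "t \<in> T"
  shows "digit b (\<Sum>s\<in>F. b ^ s * x s) (s + t) = (if s \<in> F then digit b (x s) t else 0)"
proof -
  have "digit b (\<Sum>s\<in>F. b ^ s * x s) (s + t) = (\<Sum>s'\<in>F. digit b (b ^ s' * x s') (s + t))"
    using assms(1-5) by (rule digit_shifted_sum)
  moreover have "digit b (b ^ s' * x s') (s + t) = (if s' = s then digit b (x s) t else 0)" if "s' \<in> F" for s'
  proof -
    have "s' = s" if "digit b (b ^ s' * x s') (s + t) \<noteq> 0"
    proof -
      have "s' \<le> s + t" "s + t - s' \<in> T"
        using assms(1,5) \<open>s' \<in> F\<close> that
        by (auto simp: digit_power_mult digits_in_def split: if_splits)
      then show ?thesis
        using sums_uniqueD[OF assms(2), of s' "s + t - s'" s t] \<open>s' \<in> F\<close> assms(4,6,7) by auto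
    qed
    then show ?thesis using assms(1)
      by (cases "s' = s"; cases "digit b (b ^ s' * x s') (s + t) = 0") (simp_all add: digit_power_mult)
  qed
  ultimately have "digit b (\<Sum>s\<in>F. b ^ s * x s) (s + t)
      = (\<Sum>s'\<in>F. if s' = s then digit b (x s) t else 0)"
    by (simp cong: sum.cong)
  also have "\<dots> = (if s \<in> F then digit b (x s) t else 0)"
    using assms(3) by (rule sum.delta)
  finally show ?thesis .
qed

lemma digit_shifted_sum_nonzero:
  assumes "2 \<le> b" "sums_unique S T" "finite F" "F \<subseteq> S" "x ` F \<subseteq> digits_in b T"
    and "digit b (\<Sum>s\<in>F. b ^ s * x s) e \<noteq> 0"
  obtains s t where "s \<in> F" "t \<in> T" "e = s + t" "digit b (x s) t \<noteq> 0"
proof -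
  have "digit b (\<Sum>s\<in>F. b ^ s * x s) e = (\<Sum>s\<in>F. digit b (b ^ s * x s) e)"
    using assms(1-5) by (rule digit_shifted_sum)
  then obtain s where s: "s \<in> F" "digit b (b ^ s * x s) e \<noteq> 0"
    using assms(6) by (metis (no_types, lifting) sum.neutral)
  then have "s \<le> e" "digit b (x s) (e - s) \<noteq> 0"
    using assms(1) by (auto simp: digit_power_mult split: if_splits)
  moreover from this have "e - s \<in> T"
    using assms(5) s(1) by (auto simp: digits_in_def)
  ultimately show thesis
    using that[of s "e - s"] s(1) by simp
qed

text \<open>The digits of \<open>n\<close> at the positions \<open>s + t\<close>, moved down by
  \<open>s\<close>; this inverts the shifted sum. The bound \<open>t \<le> n\<close> makes the index
  set finite and loses nothing, as a nonzero digit at \<open>e\<close> forces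
  \<open>e \<le> n\<close>.\<close>

definition slice :: "nat \<Rightarrow> nat set \<Rightarrow> nat \<Rightarrow> nat \<Rightarrow> nat" where
  "slice b T n s = (\<Sum>t | t \<in> T \<and> t \<le> n. digit b n (s + t) * b ^ t)"

lemma digit_slice:
  assumes "2 \<le> b"
  shows "digit b (slice b T n s) t = (if t \<in> T then digit b n (s + t) else 0)"
proof -
  have "digit b (slice b T n s) t = (if t \<in> {t. t \<in> T \<and> t \<le> n} then digit b n (s + t) else 0)"
    unfolding slice_def using assms by (intro digit_expansion) (auto simp: digit_less)
  then show ?thesis
    using digit_nonzero_le[OF assms, of n "s + t"]
    by (cases "digit b n (s + t) = 0") simp_all
qed

lemma slice_in_digits_in: "2 \<le> b \<Longrightarrow> slice b T n s \<in> digits_in b T"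
  by (auto simp: digits_in_def digit_slice split: if_splits)

text \<open>Both sides have the same digits: at \<open>s + t\<close> the slice was built from that
  digit of \<open>n\<close>, and at positions that are no such sum both digits are 0.\<close>

lemma sum_slices:
  assumes "2 \<le> b" "sums_unique S T" "\<And>e. digit b n e \<noteq> 0 \<Longrightarrow> \<exists>s\<in>S. \<exists>t\<in>T. e = s + t"
  shows "(\<Sum>s | s \<in> S \<and> s \<le> n. b ^ s * slice b T n s) = n"
proof (rule digit_eqI[OF assms(1)])
  fix e
  let ?F = "{s. s \<in> S \<and> s \<le> n}"
  have *: "digit b (\<Sum>s\<in>?F. b ^ s * slice b T n s) (s + t)
      = (if s \<in> ?F then digit b (slice b T n s) t else 0)" if "s \<in> S" "t \<in> T" for s t
    using assms(1,2) that by (intro digit_shifted_sum_add) (auto simp: slice_in_digits_in)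
  show "digit b (\<Sum>s\<in>?F. b ^ s * slice b T n s) e = digit b n e"
  proof (cases "\<exists>s\<in>S. \<exists>t\<in>T. e = s + t")
    case True
    then obtain s t where st: "s \<in> S" "t \<in> T" "e = s + t" by blast
    then show ?thesis
      using digit_nonzero_le[OF assms(1), of n e]
      by (cases "digit b n e = 0") (simp_all add: * digit_slice[OF assms(1)])
  next
    case False
    have "digit b (\<Sum>s\<in>?F. b ^ s * slice b T n s) e = 0"
    proof (rule ccontr)
      assume "digit b (\<Sum>s\<in>?F. b ^ s * slice b T n s) e \<noteq> 0"
      moreover have "finite ?F" "?F \<subseteq> S" "slice b T n ` ?F \<subseteq> digits_in b T"
        using slice_in_digits_in[OF assms(1)] by auto
      ultimately obtain s t where "s \<in> ?F" "t \<in> T" "e = s + t"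
        using digit_shifted_sum_nonzero[OF assms(1,2), of ?F "slice b T n" e] by blast
      then show False using False by blast
    qed
    then show ?thesis using assms(3) False by force
  qed
qed

lemma weighted_rep_in_L: "weighted_rep L B n f \<Longrightarrow> f l \<noteq> 0 \<Longrightarrow> l \<in> L"
  unfolding weighted_rep_def by blast

lemma weighted_rep_in_B: "weighted_rep L B n f \<Longrightarrow> f l \<in> B"
  unfolding weighted_rep_def by blast

lemma weighted_rep_le:
  assumes "weighted_rep L B n f" "f l \<noteq> 0"
  shows "l * f l \<le> n"
  using assms member_le_sum[of l "{l. f l \<noteq> 0}" "\<lambda>l. l * f l"] by (auto simp: weighted_rep_def)

lemma weighted_rep_le_weight:
  assumes "weighted_rep L B n f" "f l \<noteq> 0"
  shows "l \<le> n"
proof -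
  have "l * 1 \<le> l * f l" using assms(2) by (intro mult_le_mono) auto
  then show ?thesis using weighted_rep_le[OF assms] by linarith
qed

lemma weighted_rep_le_coeff:
  assumes "weighted_rep L B n f" "0 \<notin> L"
  shows "f l \<le> n"
proof (cases "f l = 0")
  case False
  then have "l \<noteq> 0" using weighted_rep_in_L[OF assms(1)] assms(2) by metis
  then have "1 * f l \<le> l * f l" by (intro mult_le_mono) auto
  then show ?thesis using weighted_rep_le[OF assms(1) False] by linarith
qed simp

lemma weighted_rep_superset:
  assumes "weighted_rep L B n f" "finite F" "{l. f l \<noteq> 0} \<subseteq> F"
  shows "n = (\<Sum>l\<in>F. l * f l)"
  using assms sum.mono_neutral_left[of F "{l. f l \<noteq> 0}" "\<lambda>l. l * f l"]
  by (auto simp: weighted_rep_def)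

lemma weighted_repI:
  assumes "finite F" "\<And>l. f l \<noteq> 0 \<Longrightarrow> l \<in> F" "F \<subseteq> L" "\<And>l. l \<in> F \<Longrightarrow> f l \<in> B" "0 \<in> B" "n = (\<Sum>l\<in>F. l * f l)"
  shows "weighted_rep L B n f"
proof -
  have supp: "{l. f l \<noteq> 0} \<subseteq> F" using assms(2) by blast
  have "f l \<in> B" for l
    using assms(2,4,5) by metis
  moreover have "n = (\<Sum>l | f l \<noteq> 0. l * f l)"
    unfolding assms(6) by (rule sum.mono_neutral_right) (use assms(1) supp in auto)
  ultimately show ?thesis
    using supp assms(1,3) finite_subset unfolding weighted_rep_def by blast
qed

lemma weighted_rep_single:
  "l \<in> L \<Longrightarrow> x \<in> B \<Longrightarrow> 0 \<in> B \<Longrightarrow> weighted_rep L B (l * x) ((\<lambda>_. 0)(l := x))"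
  by (rule weighted_repI[of "{l}"]) (auto split: if_splits)

lemma weighted_rep_insert:
  assumes "weighted_rep L B n f" "f l = 0" "l \<in> L" "x \<in> B" "0 \<in> B"
  shows "weighted_rep L B (l * x + n) (f(l := x))"
proof (rule weighted_repI[of "insert l {k. f k \<noteq> 0}"])
  have "(\<Sum>k | f k \<noteq> 0. k * (f(l := x)) k) = (\<Sum>k | f k \<noteq> 0. k * f k)"
    using assms(2) by (intro sum.cong) auto
  then show "l * x + n = (\<Sum>k\<in>insert l {k. f k \<noteq> 0}. k * (f(l := x)) k)"
    using assms(1,2) by (simp add: weighted_rep_def)
qed (use assms in \<open>auto simp: weighted_rep_def split: if_splits\<close>)

lemma weighted_rep_powers:
  assumes "2 \<le> b" "weighted_rep L B n f" "{l. f l \<noteq> 0} \<subseteq> range ((^) b)"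
  shows "finite {s. f (b ^ s) \<noteq> 0}" "n = (\<Sum>s | f (b ^ s) \<noteq> 0. b ^ s * f (b ^ s))"
proof -
  have inj: "inj_on ((^) b) X" for X
    using assms(1) by (intro inj_onI) simp
  have im: "{l. f l \<noteq> 0} = (^) b ` {s. f (b ^ s) \<noteq> 0}"
  proof (intro equalityI subsetI)
    fix l assume "l \<in> {l. f l \<noteq> 0}"
    moreover from this assms(3) obtain s where "l = b ^ s" by blast
    ultimately show "l \<in> (^) b ` {s. f (b ^ s) \<noteq> 0}" by blast
  qed auto
  have "finite ((^) b ` {s. f (b ^ s) \<noteq> 0})"
    using assms(2) unfolding weighted_rep_def im by blast
  then show "finite {s. f (b ^ s) \<noteq> 0}"
    using inj by (rule finite_imageD)
  have "n = (\<Sum>l\<in>(^) b ` {s. f (b ^ s) \<noteq> 0}. l * f l)"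
    using assms(2) unfolding weighted_rep_def im by blast
  also have "\<dots> = (\<Sum>s | f (b ^ s) \<noteq> 0. b ^ s * f (b ^ s))"
    by (simp add: sum.reindex[OF inj])
  finally show "n = (\<Sum>s | f (b ^ s) \<noteq> 0. b ^ s * f (b ^ s))" .
qed

lemma weighted_rep_from_powers:
  assumes "2 \<le> b" "finite F" "\<And>s. s \<in> F \<Longrightarrow> b ^ s \<in> L" "\<And>s. s \<in> F \<Longrightarrow> x s \<in> B" "0 \<in> B"
  shows "\<exists>f. weighted_rep L B (\<Sum>s\<in>F. b ^ s * x s) f \<and> (\<forall>s\<in>F. f (b ^ s) = x s) \<and>
    (\<forall>l. f l \<noteq> 0 \<longrightarrow> l \<in> (^) b ` F)"
proof -
  have inj: "inj_on ((^) b) F"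
    using assms(1) by (intro inj_onI) simp
  define f where "f l = (if l \<in> (^) b ` F then x (the_inv_into F ((^) b) l) else 0)" for l
  have f: "f (b ^ s) = x s" if "s \<in> F" for s
    using that by (simp add: f_def the_inv_into_f_f[OF inj])
  have supp: "l \<in> (^) b ` F" if "f l \<noteq> 0" for l
    using that by (simp add: f_def split: if_splits)
  have "weighted_rep L B (\<Sum>s\<in>F. b ^ s * x s) f"
  proof (rule weighted_repI[of "(^) b ` F"])
    show "(\<Sum>s\<in>F. b ^ s * x s) = (\<Sum>l\<in>(^) b ` F. l * f l)"
      by (simp add: sum.reindex[OF inj] f)
  qed (use assms f supp in auto)
  then show ?thesis using f supp by blast
qed

text \<open>The core of (b) implies (a): the slices of \<open>n\<close> form a representation, and
  every representation can be read off from the digits of \<open>n\<close>.\<close>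

lemma ex1_weighted_rep_powers:
  assumes "2 \<le> b" "complementing S T"
  shows "\<exists>!f. weighted_rep ((^) b ` S) (digits_in b T) n f"
proof -
  have su: "sums_unique S T" and cover: "\<And>n. \<exists>s\<in>S. \<exists>t\<in>T. n = s + t"
    using assms(2) by (auto simp: complementing_def)
  have "\<exists>f. weighted_rep ((^) b ` S) (digits_in b T) n f"
  proof -
    let ?F = "{s. s \<in> S \<and> s \<le> n}"
    have "\<exists>f. weighted_rep ((^) b ` S) (digits_in b T) (\<Sum>s\<in>?F. b ^ s * slice b T n s) f \<and>
        (\<forall>s\<in>?F. f (b ^ s) = slice b T n s) \<and> (\<forall>l. f l \<noteq> 0 \<longrightarrow> l \<in> (^) b ` ?F)"
      using assms(1) by (intro weighted_rep_from_powers) (simp_all add: slice_in_digits_in)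
    then show ?thesis
      unfolding sum_slices[OF assms(1) su cover] by blast
  qed
  moreover have "f = g" if f: "weighted_rep ((^) b ` S) (digits_in b T) n f"
    and g: "weighted_rep ((^) b ` S) (digits_in b T) n g" for f g
  proof -
    have inS: "b ^ s \<in> (^) b ` S \<longleftrightarrow> s \<in> S" for s
      using assms(1) by auto
    \<comment> \<open>Without carries, digit \<open>t\<close> of the coefficient of
      \<open>b ^ s\<close> is visible in \<open>n\<close>. For \<open>t\<close> outside
      \<open>T\<close> that digit is 0, so \<open>n\<close> determines the coefficient.\<close>
    have *: "digit b n (s + t) = digit b (f (b ^ s)) t"
      if f: "weighted_rep ((^) b ` S) (digits_in b T) n f" and "s \<in> S" "t \<in> T" for f s t
    proof -
      have "{l. f l \<noteq> 0} \<subseteq> range ((^) b)"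
        using weighted_rep_in_L[OF f] by blast
      note pow = weighted_rep_powers[OF assms(1) f this]
      have "{s. f (b ^ s) \<noteq> 0} \<subseteq> S"
        using weighted_rep_in_L[OF f] inS by blast
      moreover have "(\<lambda>s. f (b ^ s)) ` {s. f (b ^ s) \<noteq> 0} \<subseteq> digits_in b T"
        using weighted_rep_in_B[OF f] by blast
      ultimately have "digit b (\<Sum>s | f (b ^ s) \<noteq> 0. b ^ s * f (b ^ s)) (s + t)
          = (if s \<in> {s. f (b ^ s) \<noteq> 0} then digit b (f (b ^ s)) t else 0)"
        using assms(1) su pow(1) that(2,3) by (intro digit_shifted_sum_add)
      then show ?thesis
        unfolding pow(2)[symmetric] by (cases "f (b ^ s) = 0") simp_all
    qed
    have on: "f (b ^ s) = g (b ^ s)" if "s \<in> S" for s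
    proof (rule digit_eqI[OF assms(1)])
      fix t
      show "digit b (f (b ^ s)) t = digit b (g (b ^ s)) t"
      proof (cases "t \<in> T")
        case True
        then show ?thesis using *[OF f that] *[OF g that] by simp
      next
        case False
        then have "digit b (f (b ^ s)) t = 0" "digit b (g (b ^ s)) t = 0"
          using digits_inD[OF weighted_rep_in_B[OF f]] digits_inD[OF weighted_rep_in_B[OF g]] by blast+
        then show ?thesis by simp
      qed
    qed
    show ?thesis
    proof
      fix l
      show "f l = g l"
      proof (cases "l \<in> (^) b ` S")
        case True
        then show ?thesis using on by blast
      next
        case False
        then show ?thesis using weighted_rep_in_L[OF f] weighted_rep_in_L[OF g] by metis
      qed
    qed
  qed
  ultimately show ?thesis by blast
qed

subsection \<open>Structure of uniquely representing pairs\<close>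

text \<open>Condition (a) in terms of functions: \<open>L\<close> stands for the set of weights and
  \<open>B\<close> for \<open>A\<close> with 0 adjoined. Here \<open>n = 0\<close> is included,
  represented by the zero function alone.\<close>

locale unique_weighted_rep =
  fixes L B :: "nat set"
  assumes ex1_rep: "\<exists>!f. weighted_rep L B n f"
    and zero_notin_L: "0 \<notin> L"
    and zero_in_B: "0 \<in> B"
    and infinite_L: "infinite L"
    and infinite_B: "infinite B"
begin

lemma obtain_rep: obtains f where "weighted_rep L B n f"
  using ex1_rep by blast

lemma rep_unique: "weighted_rep L B n f \<Longrightarrow> weighted_rep L B n g \<Longrightarrow> f = g"
  using ex1_rep by blast

lemma product_unique:
  assumes "l * x = l' * x'" "l \<in> L" "l' \<in> L" "x \<in> B" "x' \<in> B" "x \<noteq> 0"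
  shows "l = l'" "x = x'"
proof -
  have "(\<lambda>_. 0)(l := x) = (\<lambda>_. 0)(l' := x')"
    using weighted_rep_single[OF assms(2,4) zero_in_B] weighted_rep_single[OF assms(3,5) zero_in_B]
    unfolding assms(1) by (rule rep_unique)
  from fun_cong[OF this, of l] show "l = l'" "x = x'"
    using assms(6) by (simp_all split: if_splits)
qed

text \<open>In the representation of 1 an occurring weight and its coefficient are at most 1, and
  neither is 0.\<close>

lemma one_in: "1 \<in> L" "1 \<in> B"
proof -
  obtain f where f: "weighted_rep L B 1 f" by (rule obtain_rep)
  obtain l where l: "f l \<noteq> 0"
    using f unfolding weighted_rep_def by force
  have "l \<in> L" "l \<le> 1" "f l \<le> 1"
    using weighted_rep_in_L[OF f l] weighted_rep_le_weight[OF f l]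
      weighted_rep_le_coeff[OF f zero_notin_L] by blast+
  moreover from this have "l \<noteq> 0"
    using zero_notin_L by metis
  ultimately have "l = 1" "f l = 1"
    using l by linarith+
  then show "1 \<in> L" "1 \<in> B"
    using \<open>l \<in> L\<close> weighted_rep_in_B[OF f, of l] by simp_all
qed

definition base :: nat where
  "base = (LEAST l. l \<in> L \<and> l \<noteq> 1)"

lemma base_in_L: "base \<in> L" "base \<noteq> 1" and base_least: "l \<in> L \<Longrightarrow> l < base \<Longrightarrow> l = 1"
proof -
  have "\<exists>l. l \<in> L \<and> l \<noteq> 1"
    using infinite_L by (metis finite.emptyI finite_insert finite_subset singletonI subsetI)
  then have "base \<in> L \<and> base \<noteq> 1"
    unfolding base_def by (rule LeastI_ex)
  then show "base \<in> L" "base \<noteq> 1" by simp_all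
  show "l = 1" if "l \<in> L" "l < base"
    using not_less_Least[of l "\<lambda>l. l \<in> L \<and> l \<noteq> 1"] that unfolding base_def by blast
qed

lemma base_ge_2: "2 \<le> base"
proof -
  have "base \<noteq> 0" using base_in_L(1) zero_notin_L by metis
  then show ?thesis using base_in_L(2) by linarith
qed

lemma rep_only_one:
  assumes "weighted_rep L B n f" "\<And>l. f l \<noteq> 0 \<Longrightarrow> l = 1"
  shows "n \<in> B"
proof -
  have "n = (\<Sum>l\<in>{1}. l * f l)"
    using assms by (intro weighted_rep_superset[OF assms(1)]) auto
  then show ?thesis using weighted_rep_in_B[OF assms(1), of 1] by simp
qed

text \<open>A weight occurring in a representation of \<open>n\<close> is at most \<open>n\<close>,
  hence equals 1, so \<open>n\<close> is the coefficient of 1.\<close>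

lemma small_in_B:
  assumes "n < base"
  shows "n \<in> B"
proof -
  obtain f where f: "weighted_rep L B n f" by (rule obtain_rep)
  have "l = 1" if "f l \<noteq> 0" for l
    using weighted_rep_in_L[OF f that] weighted_rep_le_weight[OF f that] assms base_least by simp
  then show ?thesis by (rule rep_only_one[OF f])
qed

section \<open>Powers of the base and the induction on structure\<close>

definition weight_exponents :: "nat set" where
  "weight_exponents = {s. base ^ s \<in> L}"

definition coeff_exponents :: "nat set" where
  "coeff_exponents = {t. base ^ t \<in> B}"

lemma zero_in_weight_exponents: "0 \<in> weight_exponents"
  using one_in(1) by (simp add: weight_exponents_def)

lemma one_in_weight_exponents: "1 \<in> weight_exponents"
  using base_in_L by (simp add: weight_exponents_def)

text \<open>Equal sums of exponents give equal products \<open>base ^ s * base ^ t\<close>, that is,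
  two one-term representations of one number.\<close>

lemma exponents_unique: "sums_unique weight_exponents coeff_exponents"
  unfolding sums_unique_def
proof (intro ballI impI)
  fix s s' t t'
  assume *: "s \<in> weight_exponents" "s' \<in> weight_exponents" "t \<in> coeff_exponents" "t' \<in> coeff_exponents"
    and "s + t = s' + t'"
  then have "base ^ s * base ^ t = base ^ s' * base ^ t'"
    by (simp flip: power_add)
  moreover have "base ^ s \<in> L" "base ^ s' \<in> L" "base ^ t \<in> B" "base ^ t' \<in> B"
    using * by (simp_all add: weight_exponents_def coeff_exponents_def)
  moreover have "base ^ t \<noteq> 0" using base_ge_2 by simp
  ultimately have "base ^ s = base ^ s'" "base ^ t = base ^ t'"
    by (fact product_unique)+
  then show "s = s' \<and> t = t'"
    using base_ge_2 by simp
qed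

text \<open>The statement proved by strong induction on \<open>n\<close>. For \<open>L\<close> it
  only claims that \<open>n\<close> is a power of \<open>base\<close>: which powers occur is
  recorded by \<open>weight_exponents\<close>.\<close>

definition structured :: "nat \<Rightarrow> bool" where
  "structured n \<longleftrightarrow>
     (n \<in> L \<longrightarrow> n \<in> range ((^) base)) \<and> (n \<in> B \<longleftrightarrow> n \<in> digits_in base coeff_exponents)"

lemma structured_rep:
  assumes rep: "weighted_rep L B n f" and str: "\<forall>l. f l \<noteq> 0 \<longrightarrow> structured l \<and> structured (f l)"
  shows "finite {s. f (base ^ s) \<noteq> 0}" "{s. f (base ^ s) \<noteq> 0} \<subseteq> weight_exponents"
    "(\<lambda>s. f (base ^ s)) ` {s. f (base ^ s) \<noteq> 0} \<subseteq> digits_in base coeff_exponents"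
    "n = (\<Sum>s | f (base ^ s) \<noteq> 0. base ^ s * f (base ^ s))"
    "\<And>l. f l \<noteq> 0 \<Longrightarrow> \<exists>s. l = base ^ s"
proof -
  have powers: "{l. f l \<noteq> 0} \<subseteq> range ((^) base)"
    using str weighted_rep_in_L[OF rep] unfolding structured_def by blast
  then show "\<exists>s. l = base ^ s" if "f l \<noteq> 0" for l
    using that by blast
  show "finite {s. f (base ^ s) \<noteq> 0}" "n = (\<Sum>s | f (base ^ s) \<noteq> 0. base ^ s * f (base ^ s))"
    using weighted_rep_powers[OF base_ge_2 rep powers] .
  show "{s. f (base ^ s) \<noteq> 0} \<subseteq> weight_exponents"
    using weighted_rep_in_L[OF rep] unfolding weight_exponents_def by blast
  show "(\<lambda>s. f (base ^ s)) ` {s. f (base ^ s) \<noteq> 0} \<subseteq> digits_in base coeff_exponents"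
    using weighted_rep_in_B[OF rep] str unfolding structured_def by blast
qed

text \<open>In the representation of \<open>base ^ e\<close> all weights and coefficients are
  structured, so no carries occur and the nonzero digit at \<open>e\<close> comes from a single
  term, which splits \<open>e\<close>.\<close>

lemma exponent_cover:
  assumes "\<And>x. x \<le> base ^ e \<Longrightarrow> structured x"
  shows "\<exists>s\<in>weight_exponents. \<exists>t\<in>coeff_exponents. e = s + t"
proof -
  obtain f where f: "weighted_rep L B (base ^ e) f" by (rule obtain_rep)
  have "\<forall>l. f l \<noteq> 0 \<longrightarrow> structured l \<and> structured (f l)"
    using assms weighted_rep_le_weight[OF f] weighted_rep_le_coeff[OF f zero_notin_L] by blast
  note st = structured_rep[OF f this]
  have "digit base (\<Sum>s | f (base ^ s) \<noteq> 0. base ^ s * f (base ^ s)) e \<noteq> 0"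
    unfolding st(4)[symmetric] using base_ge_2 by (simp add: digit_power)
  from digit_shifted_sum_nonzero[OF base_ge_2 exponents_unique st(1-3) this]
  show ?thesis using st(2) by blast
qed

text \<open>If \<open>n\<close> were in \<open>L\<close>, then \<open>base ^ (m + 1)\<close> would have, besides \<open>base \<cdot> base ^ m\<close>, a second
  representation, obtained from division with remainder by \<open>n\<close>.\<close>

lemma non_power_notin_L:
  assumes "base ^ m < n" "n < base ^ Suc m" "base ^ m \<in> B" "n \<noteq> base"
  shows "n \<notin> L"
proof
  assume n: "n \<in> L"
  define x where "x = base ^ Suc m div n"
  have "n > 0" using assms(1) by simp
  have "x \<noteq> 0"
    using assms(2) \<open>n > 0\<close> by (simp add: x_def div_eq_0_iff)
  have "base ^ Suc m < base * n"
    using assms(1) base_ge_2 by simp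
  then have "x < base"
    unfolding x_def using \<open>n > 0\<close> by (simp add: less_mult_imp_div_less)
  then have "x \<in> B" by (rule small_in_B)
  obtain g where g: "weighted_rep L B (base ^ Suc m mod n) g" by (rule obtain_rep)
  \<comment> \<open>The remainder is below \<open>n\<close>, so the weight \<open>n\<close> is still
    free to receive the coefficient \<open>x\<close>.\<close>
  have "g n = 0"
    using weighted_rep_le_weight[OF g, of n] mod_less_divisor[OF \<open>n > 0\<close>, of "base ^ Suc m"] by fastforce
  have "weighted_rep L B (n * x + base ^ Suc m mod n) (g(n := x))"
    using g \<open>g n = 0\<close> n \<open>x \<in> B\<close> zero_in_B by (rule weighted_rep_insert)
  then have "weighted_rep L B (base ^ Suc m) (g(n := x))"
    unfolding x_def by (simp only: mult_div_mod_eq)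
  moreover have "weighted_rep L B (base ^ Suc m) ((\<lambda>_. 0)(base := base ^ m))"
    using weighted_rep_single[OF base_in_L(1) assms(3) zero_in_B] by simp
  ultimately have "g(n := x) = (\<lambda>_. 0)(base := base ^ m)"
    by (rule rep_unique)
  from fun_cong[OF this, of n] show False
    using \<open>x \<noteq> 0\<close> assms(4) by simp
qed

lemma between_powers:
  assumes "n \<noteq> 0" "n \<notin> range ((^) base)"
  obtains m where "base ^ m < n" "n < base ^ Suc m" "digit base n m \<noteq> 0"
proof -
  obtain m where m: "base ^ m \<le> n" "n < base ^ Suc m"
    using ex_power_ivl1[of base n] base_ge_2 assms(1) by auto
  moreover have "n \<noteq> base ^ m" using assms(2) by blast
  moreover have "digit base n m = n div base ^ m"
    unfolding digit_def using m(2) by (intro mod_less less_mult_imp_div_less) simp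
  moreover have "n div base ^ m \<noteq> 0"
    using m(1) base_ge_2 by (simp add: div_eq_0_iff)
  ultimately show thesis using that[of m] by simp
qed

text \<open>Zero and the powers of \<open>base\<close> are immediate. Any other \<open>n\<close>
  must be kept out of \<open>L\<close>. It is put into \<open>B\<close> if its digits sit at
  positions in \<open>coeff_exponents\<close>; otherwise its slices form a representation that
  excludes it from both sets.\<close>

lemma structured_all: "structured n"
proof (induction n rule: less_induct)
  case (less n)
  let ?S = weight_exponents and ?T = coeff_exponents
  consider "n = 0" | m where "n = base ^ m" | "n \<noteq> 0" "n \<notin> range ((^) base)"
    by blast
  then show ?case
  proof cases
    case 1
    then show ?thesis
      using zero_in_B zero_notin_L by (simp add: structured_def)
  next
    case (2 m)
    then show ?thesis
      using base_ge_2 by (simp add: structured_def coeff_exponents_def power_in_digits_in)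
  next
    case 3
    obtain m where m: "base ^ m < n" "n < base ^ Suc m" "digit base n m \<noteq> 0"
      using 3 by (rule between_powers)
    show ?thesis
    proof (cases "n \<in> digits_in base ?T")
      case True
      have "base ^ m \<in> B"
        using digits_inD[OF True m(3)] by (simp add: coeff_exponents_def)
      moreover have "n \<noteq> base"
        using 3(2) power_one_right[of base] by (metis rangeI)
      ultimately have "n \<notin> L"
        using m(1,2) by (intro non_power_notin_L)
      moreover have "n \<in> B"
      proof (rule ccontr)
        assume "n \<notin> B"
        obtain f where f: "weighted_rep L B n f" by (rule obtain_rep)
        \<comment> \<open>As \<open>n\<close> is in neither set, no occurring weight or coefficient
          equals \<open>n\<close>, so the induction hypothesis covers the whole
          representation.\<close>
        have "l < n \<and> f l < n" if "f l \<noteq> 0" for l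
          using weighted_rep_in_L[OF f that] weighted_rep_in_B[OF f, of l] \<open>n \<notin> L\<close> \<open>n \<notin> B\<close>
            weighted_rep_le_weight[OF f that] weighted_rep_le_coeff[OF f zero_notin_L, of l]
          by (metis le_neq_implies_less)
        then have "\<forall>l. f l \<noteq> 0 \<longrightarrow> structured l \<and> structured (f l)"
          using less.IH by blast
        note st = structured_rep[OF f this]
        \<comment> \<open>A nonzero digit \<open>t\<close> of the coefficient of
          \<open>base ^ s\<close> survives in \<open>n\<close> at \<open>s + t\<close>, which must
          lie in \<open>?T\<close>. Then \<open>s + t\<close> and \<open>0 + (s + t)\<close> are two
          decompositions unless \<open>s = 0\<close>.\<close>
        have "l = 1" if "f l \<noteq> 0" for l
        proof -
          obtain s where s: "l = base ^ s" using st(5) \<open>f l \<noteq> 0\<close> by blast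
          have fs: "f (base ^ s) \<noteq> 0" using s \<open>f l \<noteq> 0\<close> by simp
          then have "s \<in> ?S" using st(2) by blast
          obtain t where t: "digit base (f (base ^ s)) t \<noteq> 0"
            using digit_nonzero_ex[OF base_ge_2 fs] by blast
          have "f (base ^ s) \<in> digits_in base ?T" using st(3) fs by blast
          then have "t \<in> ?T" using t by (rule digits_inD)
          have "digit base (\<Sum>s | f (base ^ s) \<noteq> 0. base ^ s * f (base ^ s)) (s + t) \<noteq> 0"
            unfolding digit_shifted_sum_add[OF base_ge_2 exponents_unique st(1-3) \<open>s \<in> ?S\<close> \<open>t \<in> ?T\<close>]
            using fs t by simp
          then have "digit base n (s + t) \<noteq> 0"
            unfolding st(4)[symmetric] .
          then have "s + t \<in> ?T" by (rule digits_inD[OF True])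
          then have "s = 0"
            using sums_uniqueD[OF exponents_unique, of s t 0 "s + t"] \<open>s \<in> ?S\<close> \<open>t \<in> ?T\<close>
              zero_in_weight_exponents by simp
          then show ?thesis using s by simp
        qed
        then have "n \<in> B" by (rule rep_only_one[OF f])
        then show False using \<open>n \<notin> B\<close> by simp
      qed
      ultimately show ?thesis using True by (simp add: structured_def)
    next
      case False
      let ?F = "{s. s \<in> ?S \<and> s \<le> n}" and ?x = "slice base ?T n"
      \<comment> \<open>Since \<open>n\<close> is not a power, \<open>base ^ e\<close> is strictly
        below \<open>n\<close>, so the induction hypothesis reaches every
        \<open>x \<le> base ^ e\<close>.\<close>
      have cover: "\<exists>s\<in>?S. \<exists>t\<in>?T. e = s + t" if "digit base n e \<noteq> 0" for e
      proof (rule exponent_cover)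
        fix x assume "x \<le> base ^ e"
        moreover have "base ^ e \<le> n" "base ^ e \<noteq> n"
          using digit_nonzero_bound[OF that] 3(2) by blast+
        ultimately have "x < n" by linarith
        then show "structured x" by (rule less.IH)
      qed
      have n: "(\<Sum>s\<in>?F. base ^ s * ?x s) = n"
        using base_ge_2 exponents_unique cover by (rule sum_slices)
      \<comment> \<open>A slice is at most \<open>n\<close>, and differs from \<open>n\<close>
        because its digits sit in \<open>?T\<close>; hence it is smaller and the induction
        hypothesis applies.\<close>
      have "?x s \<in> B" if "s \<in> ?F" for s
      proof -
        have "base ^ s * ?x s \<le> (\<Sum>s\<in>?F. base ^ s * ?x s)"
          using that by (intro member_le_sum) auto
        moreover have "1 * ?x s \<le> base ^ s * ?x s"
          using base_ge_2 by (intro mult_le_mono) auto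
        ultimately have "?x s \<le> n" unfolding n by linarith
        moreover have "?x s \<in> digits_in base ?T"
          using base_ge_2 by (rule slice_in_digits_in)
        moreover from this have "?x s \<noteq> n" using False by metis
        ultimately show ?thesis using less.IH[of "?x s"] by (simp add: structured_def)
      qed
      then have "\<exists>f. weighted_rep L B (\<Sum>s\<in>?F. base ^ s * ?x s) f \<and> (\<forall>s\<in>?F. f (base ^ s) = ?x s) \<and>
          (\<forall>l. f l \<noteq> 0 \<longrightarrow> l \<in> (^) base ` ?F)"
        using base_ge_2 zero_in_B
        by (intro weighted_rep_from_powers) (simp_all add: weight_exponents_def)
      then obtain f where f: "weighted_rep L B n f" "\<forall>s\<in>?F. f (base ^ s) = ?x s"
          "\<forall>l. f l \<noteq> 0 \<longrightarrow> l \<in> (^) base ` ?F"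
        unfolding n by blast
      \<comment> \<open>Otherwise \<open>n\<close> with weight 1 is a second representation.
        Comparison at the weight \<open>1 = base ^ 0\<close> makes \<open>n\<close> equal to its
        slice at 0, whose digits sit in \<open>?T\<close>.\<close>
      have "n \<notin> B"
      proof
        assume "n \<in> B"
        have "weighted_rep L B n ((\<lambda>_. 0)(1 := n))"
          using weighted_rep_single[OF one_in(1) \<open>n \<in> B\<close> zero_in_B] by simp
        then have "f = (\<lambda>_. 0)(1 := n)" by (rule rep_unique[OF f(1)])
        moreover have "f 1 = ?x 0" using f(2) zero_in_weight_exponents by force
        ultimately have "n = ?x 0" by simp
        then show False using False slice_in_digits_in[OF base_ge_2] by metis
      qed
      \<comment> \<open>Otherwise \<open>n\<close> would occur as a weight in \<open>f\<close>, all
        of whose weights are powers of \<open>base\<close>.\<close>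
      moreover have "n \<notin> L"
      proof
        assume "n \<in> L"
        have "weighted_rep L B n ((\<lambda>_. 0)(n := 1))"
          using weighted_rep_single[OF \<open>n \<in> L\<close> one_in(2) zero_in_B] by simp
        then have "f = (\<lambda>_. 0)(n := 1)" by (rule rep_unique[OF f(1)])
        then have "f n \<noteq> 0" by simp
        then show False using f(3) 3(2) by blast
      qed
      ultimately show ?thesis using False by (simp add: structured_def)
    qed
  qed
qed

lemma L_eq_powers: "L = (^) base ` weight_exponents"
  using structured_all unfolding structured_def weight_exponents_def by blast

lemma B_eq_digits_in: "B = digits_in base coeff_exponents"
  using structured_all unfolding structured_def by blast

lemma complementing_exponents: "complementing weight_exponents coeff_exponents"
  using exponents_unique exponent_cover structured_all by (simp add: complementing_def)

lemma infinite_weight_exponents: "infinite weight_exponents"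
  using infinite_L L_eq_powers by (metis finite_imageI)

lemma infinite_coeff_exponents: "infinite coeff_exponents"
  using infinite_B B_eq_digits_in finite_digits_in[OF base_ge_2] by metis

end

subsection \<open>Complementing pairs of sets of natural numbers\<close>

lemma complementing_zero:
  assumes "complementing S T"
  shows "0 \<in> S" "0 \<in> T"
proof -
  obtain s t where "s \<in> S" "t \<in> T" "0 = s + t"
    using assms unfolding complementing_def by blast
  then show "0 \<in> S" "0 \<in> T" by simp_all
qed

lemma complementing_unique:
  assumes "complementing S T" "s + t = s' + t'" "s \<in> S" "s' \<in> S" "t \<in> T" "t' \<in> T"
  shows "s = s'" "t = t'"
  using assms sums_uniqueD[of S T s t s' t'] unfolding complementing_def by blast+

text \<open>De Bruijn's argument, by strong induction on \<open>k\<close>: the decomposition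
  \<open>k * g = c + d\<close> decides whether the block starting at \<open>k * g\<close> is
  contained in \<open>S\<close>, has just its first element in \<open>T\<close>, or misses both
  sets.\<close>

lemma complementing_block:
  assumes ST: "complementing S T" and g: "g \<in> T" "g \<noteq> 0" and least: "\<And>t. t \<in> T \<Longrightarrow> t < g \<Longrightarrow> t = 0"
  shows "(\<forall>r<g. k * g + r \<in> S \<longleftrightarrow> k * g \<in> S) \<and> (\<forall>r<g. k * g + r \<in> T \<longrightarrow> r = 0)"
proof (induction k rule: less_induct)
  case (less k)
  note zero = complementing_zero[OF ST]
  note unique = complementing_unique[OF ST]
  have cover: "\<exists>s\<in>S. \<exists>t\<in>T. n = s + t" for n
    using ST unfolding complementing_def by blast
  have small: "r \<in> S" if "r < g" for r
  proof -
    obtain s t where st: "s \<in> S" "t \<in> T" "r = s + t" using cover by blast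
    then have "t = 0" using least that by simp
    then show ?thesis using st by simp
  qed
  \<comment> \<open>By the induction hypothesis \<open>T\<close> meets each earlier block at most in
    its first element.\<close>
  have multiple: "\<exists>j<k. t = j * g" if "t \<in> T" "t < k * g" for t
  proof -
    have "t div g < k" using that(2) by (rule less_mult_imp_div_less)
    moreover have "t = t div g * g + t mod g" "t mod g < g" using g(2) by simp_all
    ultimately have "t mod g = 0" using less.IH that(1) by metis
    then have "g dvd t" by (rule mod_0_imp_dvd)
    then have "t = t div g * g" by simp
    with \<open>t div g < k\<close> show ?thesis by (intro exI[of _ "t div g"] conjI)
  qed
  show ?case
  proof (cases "k = 0")
    case True
    then show ?thesis using small least zero by auto
  next
    case False
    then have kg: "g \<le> k * g" "0 < k * g" using g(2) by simp_all
    obtain c d where cd: "c \<in> S" "d \<in> T" "k * g = c + d" using cover by blast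
    consider "d = 0" | "d \<noteq> 0" "c = 0" | "d \<noteq> 0" "c \<noteq> 0" by blast
    then show ?thesis
    proof cases
      case 1
      then have kS: "k * g \<in> S" using cd by simp
      have T: "r = 0" if "r < g" "k * g + r \<in> T" for r
      proof (rule ccontr)
        assume "r \<noteq> 0"
        \<comment> \<open>This sum competes with the decomposition of \<open>k * g + g\<close> into
          \<open>k * g\<close> from \<open>S\<close> and \<open>g\<close> from
          \<open>T\<close>.\<close>
        then have "g - r \<in> S" "(g - r) + (k * g + r) = k * g + g" using small that(1) g(2) by simp_all
        then have "g - r = k * g" using unique(1)[OF _ _ kS that(2) g(1)] by blast
        then show False using kg \<open>r \<noteq> 0\<close> that(1) by linarith
      qed
      have "k * g + r \<in> S" if "r < g" for r
      proof -
        obtain s t where st: "s \<in> S" "t \<in> T" "k * g + r = s + t" using cover by blast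
        \<comment> \<open>If \<open>t = j * g\<close> with \<open>0 < j < k\<close>, then
          \<open>s\<close> lies in block \<open>k - j\<close>, so \<open>(k - j) * g\<close> is in
          \<open>S\<close> and \<open>k * g\<close> gets a second decomposition. If
          \<open>t \<ge> k * g\<close>, then \<open>t = k * g\<close> lies in both \<open>S\<close>
          and \<open>T\<close>.\<close>
        have "t = 0"
        proof (cases "t < k * g")
          case True
          then obtain j where j: "j < k" "t = j * g" using multiple st(2) by blast
          have split: "(k - j) * g + j * g = k * g" using j(1) by (simp flip: add_mult_distrib)
          show ?thesis
          proof (cases "j = 0")
            case True then show ?thesis using j by simp
          next
            case False
            have "s = (k - j) * g + r" using st(3) split j(2) by linarith
            moreover have "k - j < k" using False j(1) by simp
            ultimately have "(k - j) * g \<in> S" using less.IH that st(1) by metis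
            then show ?thesis
              using unique(2)[of "(k - j) * g" t "k * g" 0] kS st(2) zero(2) split j(2) by simp
          qed
        next
          case False
          then obtain q where q: "t = k * g + q" by (metis le_Suc_ex not_less)
          then have "q < g" using st(3) that by linarith
          then have "t = k * g" using T st(2) q by simp
          then show ?thesis
            using unique(2)[of "k * g" 0 0 t] kS zero st(2) by simp
        qed
        then show ?thesis using st by simp
      qed
      then show ?thesis using T kS by blast
    next
      case 2
      then have kT: "k * g \<in> T" using cd by simp
      have "k * g + r \<notin> S" if "r < g" for r
        using unique(2)[of "k * g + r" 0 r "k * g"] small[OF that] zero(2) kT kg(2) by auto
      moreover have "r = 0" if "r < g" "k * g + r \<in> T" for r
        using unique(1)[of r "k * g" 0 "k * g + r"] small[OF that(1)] zero(1) kT that(2) by simp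
      moreover have "k * g \<notin> S" using calculation(1)[of 0] g(2) by simp
      ultimately show ?thesis by blast
    next
      case 3
      then have "d < k * g" using cd(3) by linarith
      then obtain j where j: "j < k" "d = j * g" using multiple cd(2) by blast
      have split: "(k - j) * g + j * g = k * g" using j(1) by (simp flip: add_mult_distrib)
      have "c = (k - j) * g" using cd(3) split j(2) by linarith
      moreover have "j \<noteq> 0" using 3(1) j(2) by auto
      \<comment> \<open>As \<open>c\<close> starts an earlier block, every \<open>c + r\<close> is
        in \<open>S\<close>. Then \<open>(c + r) + d\<close> decomposes \<open>k * g + r\<close>
        into two nonzero parts, which excludes that number from \<open>S\<close> and from
        \<open>T\<close>.\<close>
      ultimately have cr: "c + r \<in> S" if "r < g" for r
        using less.IH[of "k - j"] j(1) cd(1) that by simp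
      have "k * g + r \<notin> S" if "r < g" for r
        using unique(2)[of "k * g + r" 0 "c + r" d] cr[OF that] zero(2) cd 3(1) by auto
      moreover have "k * g + r \<notin> T" if "r < g" for r
        using unique(1)[of "c + r" d 0 "k * g + r"] cr[OF that] zero(1) cd 3(2) by auto
      moreover have "k * g \<notin> S" using calculation(1)[of 0] g(2) by simp
      ultimately show ?thesis by blast
    qed
  qed
qed

section \<open>The descent step on complementing pairs\<close>

definition least_pos :: "nat set \<Rightarrow> nat" where
  "least_pos T = (LEAST t. t \<in> T \<and> t \<noteq> 0)"

definition dilate_inv :: "nat \<Rightarrow> nat set \<Rightarrow> nat set" where
  "dilate_inv g X = {y. g * y \<in> X}"

text \<open>Membership of 1 fixes which of the two sets comes first; infiniteness provides a least
  positive element at every stage of the descent.\<close>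

definition splitting :: "nat set \<times> nat set \<Rightarrow> bool" where
  "splitting p \<longleftrightarrow> complementing (fst p) (snd p) \<and> 1 \<in> fst p \<and> infinite (fst p) \<and> infinite (snd p)"

text \<open>The components are exchanged because \<open>g\<close> lies in the second set, so after
  division by \<open>g\<close> it is this set that contains 1.\<close>

definition descend :: "nat set \<times> nat set \<Rightarrow> nat set \<times> nat set" where
  "descend p = (let g = least_pos (snd p) in (dilate_inv g (snd p), dilate_inv g (fst p)))"

lemma least_pos:
  assumes "infinite T"
  shows "least_pos T \<in> T" "least_pos T \<noteq> 0" "t \<in> T \<Longrightarrow> t < least_pos T \<Longrightarrow> t = 0"
proof -
  have "\<exists>t. t \<in> T \<and> t \<noteq> 0"
    using assms by (metis finite.emptyI finite_insert finite_subset singletonI subsetI)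
  then have "least_pos T \<in> T \<and> least_pos T \<noteq> 0"
    unfolding least_pos_def by (rule LeastI_ex)
  then show "least_pos T \<in> T" "least_pos T \<noteq> 0" by simp_all
  show "t = 0" if "t \<in> T" "t < least_pos T"
    using not_less_Least[of t "\<lambda>t. t \<in> T \<and> t \<noteq> 0"] that unfolding least_pos_def by blast
qed

lemma splitting_least_pos_ge_2:
  assumes "splitting (S, T)"
  shows "2 \<le> least_pos T"
proof -
  have ST: "complementing S T" "1 \<in> S" "infinite T" using assms by (simp_all add: splitting_def)
  have "1 \<notin> T"
    using complementing_unique(1)[OF ST(1), of 1 0 0 1] complementing_zero[OF ST(1)] ST(2) by auto
  then have "least_pos T \<noteq> 1" using least_pos(1)[OF ST(3)] by metis
  then show ?thesis using least_pos(2)[OF ST(3)] by linarith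
qed

text \<open>\<open>S\<close> is a union of full blocks of length \<open>least_pos T\<close>, so only
  the quotient matters.\<close>

lemma splitting_in_first:
  assumes "splitting (S, T)"
  shows "x \<in> S \<longleftrightarrow> x div least_pos T \<in> dilate_inv (least_pos T) S"
proof -
  let ?g = "least_pos T"
  have ST: "complementing S T" "infinite T" using assms by (simp_all add: splitting_def)
  have "x div ?g * ?g + x mod ?g \<in> S \<longleftrightarrow> x div ?g * ?g \<in> S"
    using complementing_block[OF ST(1) least_pos(1,2)[OF ST(2)] least_pos(3)[OF ST(2)]]
      mod_less_divisor[of ?g x] least_pos(2)[OF ST(2)] by blast
  then show ?thesis by (simp add: dilate_inv_def mult.commute)
qed

lemma splitting_in_second:
  assumes "splitting (S, T)"
  shows "x \<in> T \<longleftrightarrow> least_pos T dvd x \<and> x div least_pos T \<in> dilate_inv (least_pos T) T"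
proof -
  let ?g = "least_pos T"
  have ST: "complementing S T" "infinite T" using assms by (simp_all add: splitting_def)
  have "x div ?g * ?g + x mod ?g \<in> T \<longrightarrow> x mod ?g = 0"
    using complementing_block[OF ST(1) least_pos(1,2)[OF ST(2)] least_pos(3)[OF ST(2)]]
      mod_less_divisor[of ?g x] least_pos(2)[OF ST(2)] by blast
  then have "x \<in> T \<longrightarrow> ?g dvd x" by (simp add: dvd_eq_mod_eq_0)
  then show ?thesis by (auto simp: dilate_inv_def)
qed

lemma splitting_descend:
  assumes "splitting (S, T)"
  shows "splitting (descend (S, T))"
proof -
  let ?g = "least_pos T"
  let ?S = "dilate_inv ?g S" and ?T = "dilate_inv ?g T"
  have ST: "complementing S T" "1 \<in> S" "infinite S" "infinite T" using assms by (simp_all add: splitting_def)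
  have g: "?g \<in> T" "?g \<noteq> 0" using least_pos[OF ST(4)] by simp_all
  have "sums_unique ?T ?S"
    unfolding sums_unique_def
  proof (intro ballI impI)
    fix a a' b b' assume "a \<in> ?T" "a' \<in> ?T" "b \<in> ?S" "b' \<in> ?S" "a + b = a' + b'"
    moreover from this have "?g * b + ?g * a = ?g * b' + ?g * a'"
      by (simp flip: add_mult_distrib2 add: add.commute)
    ultimately have "?g * b = ?g * b'" "?g * a = ?g * a'"
      using complementing_unique[OF ST(1), of "?g * b" "?g * a" "?g * b'" "?g * a'"]
      by (simp_all add: dilate_inv_def)
    then show "a = a' \<and> b = b'" using g(2) by simp
  qed
  moreover have "\<exists>a\<in>?T. \<exists>b\<in>?S. n = a + b" for n
  proof -
    obtain s t where st: "s \<in> S" "t \<in> T" "?g * n = s + t"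
      using ST(1) unfolding complementing_def by blast
    \<comment> \<open>\<open>T\<close> consists of multiples of \<open>?g\<close>, so
      \<open>?g\<close> divides both summands of \<open>?g * n\<close>, and the decomposition can be
      divided by \<open>?g\<close>.\<close>
    have "?g dvd t" using splitting_in_second[OF assms] st(2) by blast
    then have "?g dvd s" using st(3) by (metis dvd_add_left_iff dvd_triv_left)
    obtain a b where "t = ?g * a" "s = ?g * b" using \<open>?g dvd t\<close> \<open>?g dvd s\<close> unfolding dvd_def by blast
    then have "a \<in> ?T" "b \<in> ?S" "?g * n = ?g * (a + b)"
      using st by (simp_all add: dilate_inv_def add_mult_distrib2)
    then show ?thesis using g(2) by (metis mult_left_cancel)
  qed
  moreover have "1 \<in> ?T" using g(1) by (simp add: dilate_inv_def)
  moreover have "infinite ?T"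
  proof
    assume "finite ?T"
    then have "finite ((*) ?g ` ?T)" by simp
    moreover have "T \<subseteq> (*) ?g ` ?T"
      using splitting_in_second[OF assms] by (metis dvd_mult_div_cancel image_eqI subsetI)
    ultimately show False using ST(4) finite_subset by blast
  qed
  moreover have "infinite ?S"
  proof
    assume "finite ?S"
    then have "finite ((\<lambda>(y, r). ?g * y + r) ` (?S \<times> {..<?g}))" by simp
    moreover have "S \<subseteq> (\<lambda>(y, r). ?g * y + r) ` (?S \<times> {..<?g})"
    proof
      fix x assume "x \<in> S"
      then have "(x div ?g, x mod ?g) \<in> ?S \<times> {..<?g}"
        using splitting_in_first[OF assms, of x] g(2) by simp
      then show "x \<in> (\<lambda>(y, r). ?g * y + r) ` (?S \<times> {..<?g})"
        by (rule rev_image_eqI) simp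
    qed
    ultimately show False using ST(3) finite_subset by blast
  qed
  ultimately show ?thesis
    by (simp add: splitting_def descend_def complementing_def Let_def)
qed

section \<open>Recursion for the sets S and T\<close>

lemma partial_prod_0 [simp]: "partial_prod u 0 = 1"
  by (simp add: partial_prod_def)

lemma partial_prod_Suc: "partial_prod u (Suc h) = u 1 * partial_prod (\<lambda>i. u (Suc i)) h"
  unfolding partial_prod_def by (induction h) (simp_all add: mult.assoc)

text \<open>The summand for \<open>h = 0\<close> is the remainder modulo \<open>u 1\<close>.
  Removing it and dividing by \<open>u 1\<close> leaves a \<open>T\<close>-sum with \<open>v\<close>
  in the role of \<open>u\<close> and the tail of \<open>u\<close> in the role of
  \<open>v\<close>.\<close>

lemma S_fin_Suc:
  assumes "0 < u 1"
  shows "S_fin u v (Suc k) = {x. x div u 1 \<in> T_fin v (\<lambda>i. u (Suc i)) k}"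
proof -
  let ?u = "\<lambda>i. u (Suc i)"
  have sum: "(\<Sum>h<Suc k. i h * partial_prod u h * partial_prod v h)
      = u 1 * (\<Sum>h<k. i (Suc h) * partial_prod v (h + 1) * partial_prod ?u h) + i 0" for i
    by (simp add: sum.lessThan_Suc_shift partial_prod_Suc sum_distrib_left mult_ac del: sum.lessThan_Suc)
  show ?thesis
  proof (intro equalityI subsetI)
    fix x assume "x \<in> S_fin u v (Suc k)"
    then obtain i where i: "\<forall>h<Suc k. i h < u (h + 1)"
      "x = (\<Sum>h<Suc k. i h * partial_prod u h * partial_prod v h)"
      unfolding S_fin_def by blast
    have "i 0 < u 1" using i(1) by simp
    then have "x div u 1 = (\<Sum>h<k. i (Suc h) * partial_prod v (h + 1) * partial_prod ?u h)"
      unfolding i(2) sum by simp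
    moreover have "\<forall>h<k. i (Suc h) < ?u (h + 1)" using i(1) by simp
    ultimately show "x \<in> {x. x div u 1 \<in> T_fin v ?u k}"
      unfolding T_fin_def by (intro CollectI exI[of _ "\<lambda>h. i (Suc h)"]) simp
  next
    fix x assume "x \<in> {x. x div u 1 \<in> T_fin v ?u k}"
    then obtain j where j: "\<forall>h<k. j h < ?u (h + 1)"
      "x div u 1 = (\<Sum>h<k. j h * partial_prod v (h + 1) * partial_prod ?u h)"
      unfolding T_fin_def by blast
    define i where "i = case_nat (x mod u 1) j"
    have "x = (\<Sum>h<Suc k. i h * partial_prod u h * partial_prod v h)"
      unfolding sum by (simp add: i_def flip: j(2)[simplified])
    moreover have "\<forall>h<Suc k. i h < u (h + 1)"
      using j(1) assms by (simp add: i_def split: nat.split)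
    ultimately show "x \<in> S_fin u v (Suc k)"
      unfolding S_fin_def by blast
  qed
qed

lemma T_fin_shift: "T_fin u v k = (*) (u 1) ` S_fin v (\<lambda>i. u (Suc i)) k"
proof -
  let ?u = "\<lambda>i. u (Suc i)"
  have sum: "(\<Sum>h<k. j h * partial_prod u (h + 1) * partial_prod v h)
      = u 1 * (\<Sum>h<k. j h * partial_prod v h * partial_prod ?u h)" for j
    by (simp add: partial_prod_Suc sum_distrib_left mult_ac)
  show ?thesis unfolding T_fin_def S_fin_def sum by blast
qed

lemma zero_in_S_inf: "0 < u 1 \<Longrightarrow> 0 \<in> S_inf u v"
  unfolding S_inf_def S_fin_def by (intro UN_I[of 1] CollectI exI[of _ "\<lambda>_. 0"]) simp_all

lemma zero_in_T_inf: "0 < v 1 \<Longrightarrow> 0 \<in> T_inf u v"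
  unfolding T_inf_def T_fin_def by (intro UN_I[of 1] CollectI exI[of _ "\<lambda>_. 0"]) simp_all

lemma in_S_inf_iff:
  assumes "0 < u 1" "0 < u 2"
  shows "x \<in> S_inf u v \<longleftrightarrow> x div u 1 \<in> T_inf v (\<lambda>i. u (Suc i))"
proof -
  let ?T = "T_fin v (\<lambda>i. u (Suc i))"
  have "x \<in> S_inf u v \<longleftrightarrow> (\<exists>k. x \<in> S_fin u v (Suc k))"
    unfolding S_inf_def by (auto simp: Suc_le_eq gr0_conv_Suc)
  also have "\<dots> \<longleftrightarrow> (\<exists>k. x div u 1 \<in> ?T k)"
    using S_fin_Suc[of u v] assms(1) by simp
  also have "\<dots> \<longleftrightarrow> x div u 1 \<in> T_inf v (\<lambda>i. u (Suc i))"
  proof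
    assume "\<exists>k. x div u 1 \<in> ?T k"
    then obtain k where k: "x div u 1 \<in> ?T k" ..
    show "x div u 1 \<in> T_inf v (\<lambda>i. u (Suc i))"
    \<comment> \<open>The union in \<open>T_inf\<close> starts at 1; the empty sum 0 arising for
      \<open>k = 0\<close> still belongs to it because \<open>u 2\<close>, the first entry of the
      tail, is positive.\<close>
    proof (cases "k = 0")
      case True
      then have "x div u 1 = 0" using k by (simp add: T_fin_def)
      then show ?thesis using zero_in_T_inf[of "\<lambda>i. u (Suc i)" v] assms(2) by (simp add: numeral_2_eq_2)
    next
      case False
      then show ?thesis using k unfolding T_inf_def by (intro UN_I[of k]) simp_all
    qed
  qed (auto simp: T_inf_def)
  finally show ?thesis .
qed

lemma in_T_inf_iff:
  assumes "0 < u 1"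
  shows "x \<in> T_inf u v \<longleftrightarrow> u 1 dvd x \<and> x div u 1 \<in> S_inf v (\<lambda>i. u (Suc i))"
proof -
  have "T_inf u v = (*) (u 1) ` S_inf v (\<lambda>i. u (Suc i))"
    unfolding T_inf_def S_inf_def T_fin_shift[of u] by (simp add: image_UN)
  then show ?thesis using assms by force
qed

text \<open>Strong induction on \<open>n\<close>: division by \<open>u 1\<close> turns
  decompositions of \<open>n\<close> for \<open>u\<close> and \<open>v\<close> into decompositions
  of \<open>n div u 1\<close> for \<open>v\<close> and the tail of \<open>u\<close>, with the two
  sets exchanged.\<close>

lemma complementing_S_inf_T_inf:
  assumes "\<And>i. 1 \<le> i \<Longrightarrow> 2 \<le> u i \<and> 2 \<le> v i"
  shows "complementing (S_inf u v) (T_inf u v)"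
proof -
  have "(\<exists>s\<in>S_inf u v. \<exists>t\<in>T_inf u v. n = s + t) \<and>
      (\<forall>s\<in>S_inf u v. \<forall>s'\<in>S_inf u v. \<forall>t\<in>T_inf u v. \<forall>t'\<in>T_inf u v.
        s + t = n \<and> s' + t' = n \<longrightarrow> s = s' \<and> t = t')" for n
    using assms
  proof (induction n arbitrary: u v rule: less_induct)
    case (less n)
    let ?u = "\<lambda>i. u (Suc i)"
    have u: "2 \<le> u 1" "0 < u 1" "0 < u 2" "0 < v 1"
      using less.prems[of 1] less.prems[of 2] by simp_all
    note S = in_S_inf_iff[of u, OF u(2,3)] and T = in_T_inf_iff[of u, OF u(2)]
    show ?case
    proof (cases "n = 0")
      case True
      have "0 \<in> S_inf u v" "0 \<in> T_inf u v"
        using u zero_in_S_inf zero_in_T_inf by blast+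
      then show ?thesis using True by simp
    next
      case False
      have "n div u 1 < n" using False u(1) by simp
      moreover have "2 \<le> v i \<and> 2 \<le> ?u i" if "1 \<le> i" for i
        using less.prems[of i] less.prems[of "Suc i"] that by simp
      ultimately have IH: "\<exists>s\<in>S_inf v ?u. \<exists>t\<in>T_inf v ?u. n div u 1 = s + t"
        "\<And>s s' t t'. s \<in> S_inf v ?u \<Longrightarrow> s' \<in> S_inf v ?u \<Longrightarrow> t \<in> T_inf v ?u \<Longrightarrow> t' \<in> T_inf v ?u \<Longrightarrow>
          s + t = n div u 1 \<Longrightarrow> s' + t' = n div u 1 \<Longrightarrow> s = s' \<and> t = t'"
        using less.IH[of "n div u 1" v ?u] by blast+
      have "\<exists>s\<in>S_inf u v. \<exists>t\<in>T_inf u v. n = s + t"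
      proof -
        obtain s t where st: "s \<in> S_inf v ?u" "t \<in> T_inf v ?u" "n div u 1 = s + t"
          using IH(1) by blast
        have "u 1 * t + n mod u 1 \<in> S_inf u v" "u 1 * s \<in> T_inf u v"
          unfolding S T using st u(2) by simp_all
        moreover have "n = (u 1 * t + n mod u 1) + u 1 * s"
        proof -
          have "n = u 1 * (s + t) + n mod u 1" unfolding st(3)[symmetric] by simp
          then show ?thesis by (simp add: add_mult_distrib2)
        qed
        ultimately show ?thesis by blast
      qed
      moreover have "s = s' \<and> t = t'"
        if in_S: "s \<in> S_inf u v" "s' \<in> S_inf u v" and in_T: "t \<in> T_inf u v" "t' \<in> T_inf u v"
          and sums: "s + t = n" "s' + t' = n" for s s' t t'
      proof -
        have dvd: "u 1 dvd t" "u 1 dvd t'" using in_T unfolding T by simp_all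
        have "n div u 1 = s div u 1 + t div u 1"
          unfolding sums(1)[symmetric] using dvd(1) by (rule div_plus_div_distrib_dvd_right)
        moreover have "n div u 1 = s' div u 1 + t' div u 1"
          unfolding sums(2)[symmetric] using dvd(2) by (rule div_plus_div_distrib_dvd_right)
        ultimately have "t div u 1 + s div u 1 = n div u 1" "t' div u 1 + s' div u 1 = n div u 1"
          by linarith+
        then have "t div u 1 = t' div u 1"
          using IH(2) in_S in_T unfolding S T by blast
        then have "t = t'" using dvd by (metis dvd_mult_div_cancel)
        then show ?thesis using sums by simp
      qed
      ultimately show ?thesis by blast
    qed
  qed
  then show ?thesis
    unfolding complementing_def sums_unique_def by blast
qed

text \<open>The interleaved radices \<open>w\<^sub>0, w\<^sub>1, w\<^sub>2, \<dots>\<close> are read off as \<open>u\<^sub>1, v\<^sub>1, u\<^sub>2, \<dots>\<close> by \<open>n = 0, 1\<close>.\<close>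

definition every_second :: "(nat \<Rightarrow> nat) \<Rightarrow> nat \<Rightarrow> nat \<Rightarrow> nat" where
  "every_second w n i = w (n + 2 * i - 2)"

text \<open>Iterate the descent and let \<open>w n\<close> be the least positive element at stage
  \<open>n\<close>. The descended pair and the sets built from the radices
  \<open>w n, w (n + 1), ...\<close> obey the same recursion under division by \<open>w n\<close>,
  hence coincide.\<close>

lemma splitting_classification:
  assumes "splitting (S, T)"
  obtains u v where "\<forall>i\<ge>1. 2 \<le> u i \<and> 2 \<le> v i" "S = S_inf u v" "T = T_inf u v"
proof -
  define P where "P n = (descend ^^ n) (S, T)" for n
  define w where "w n = least_pos (snd (P n))" for n
  have P_Suc: "P (Suc n) = descend (P n)" for n
    by (simp add: P_def)
  have split: "splitting (P n)" for n
  proof (induction n)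
    case 0
    then show ?case using assms by (simp add: P_def)
  next
    case (Suc n)
    then show ?case
      unfolding P_Suc using splitting_descend[of "fst (P n)" "snd (P n)"] by simp
  qed
  then have w: "2 \<le> w n" for n
    unfolding w_def using splitting_least_pos_ge_2[of "fst (P n)" "snd (P n)"] by simp
  have first: "x \<in> fst (P n) \<longleftrightarrow> x div w n \<in> snd (P (Suc n))" for x n
    using splitting_in_first[of "fst (P n)" "snd (P n)" x] split[of n]
    by (simp add: P_Suc w_def descend_def Let_def)
  have second: "x \<in> snd (P n) \<longleftrightarrow> w n dvd x \<and> x div w n \<in> fst (P (Suc n))" for x n
    using splitting_in_second[of "fst (P n)" "snd (P n)" x] split[of n]
    by (simp add: P_Suc w_def descend_def Let_def)
  let ?S = "\<lambda>n. S_inf (every_second w n) (every_second w (Suc n))"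
  let ?T = "\<lambda>n. T_inf (every_second w n) (every_second w (Suc n))"
  have head: "every_second w n 1 = w n" "every_second w n 2 = w (Suc (Suc n))" for n
    by (simp_all add: every_second_def)
  \<comment> \<open>Dropping the first entry moves the start by 2, so the recursion leads from stage
    \<open>n\<close> exactly to the exchanged pair of stage \<open>n + 1\<close>.\<close>
  have shift: "(\<lambda>i. every_second w n (Suc i)) = every_second w (Suc (Suc n))" for n
    by (rule ext) (simp add: every_second_def)
  have pos: "0 < w n" for n using w[of n] by simp
  have head_pos: "0 < every_second w n 1" "0 < every_second w n 2" for n
    unfolding head by (rule pos)+
  have first': "x \<in> ?S n \<longleftrightarrow> x div w n \<in> ?T (Suc n)" for x n
    using in_S_inf_iff[of "every_second w n" x "every_second w (Suc n)", OF head_pos]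
    unfolding head shift .
  have second': "x \<in> ?T n \<longleftrightarrow> w n dvd x \<and> x div w n \<in> ?S (Suc n)" for x n
    using in_T_inf_iff[of "every_second w n" x "every_second w (Suc n)", OF head_pos(1)]
    unfolding head shift .
  \<comment> \<open>Division by \<open>w n \<ge> 2\<close> makes a positive \<open>x\<close> smaller
    while the stage increases; therefore \<open>n\<close> is arbitrary in the induction.\<close>
  have same: "(x \<in> fst (P n) \<longleftrightarrow> x \<in> ?S n) \<and> (x \<in> snd (P n) \<longleftrightarrow> x \<in> ?T n)" for x n
  proof (induction x arbitrary: n rule: less_induct)
    case (less x)
    show ?case
    proof (cases "x = 0")
      case True
      have "0 \<in> fst (P n)" "0 \<in> snd (P n)"
        using split[of n] complementing_zero unfolding splitting_def by blast+
      moreover have "0 \<in> ?S n" "0 \<in> ?T n"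
        using zero_in_S_inf[of "every_second w n"] zero_in_T_inf[of "every_second w (Suc n)"] pos
        unfolding head by blast+
      ultimately show ?thesis using True by simp
    next
      case False
      then have "x div w n < x" using w[of n] by simp
      then show ?thesis
        using less.IH[of "x div w n" "Suc n"]
        unfolding first[of x n] second[of x n] first'[of x n] second'[of x n] by blast
    qed
  qed
  show thesis
  proof (rule that)
    show "\<forall>i\<ge>1. 2 \<le> every_second w 0 i \<and> 2 \<le> every_second w (Suc 0) i"
      using w by (simp add: every_second_def)
    show "S = S_inf (every_second w 0) (every_second w (Suc 0))"
      "T = T_inf (every_second w 0) (every_second w (Suc 0))"
      using same[of _ 0] by (auto simp: P_def)
  qed
qed

subsection \<open>Representations by tuples\<close>

lemma ex1_transfer:
  assumes "\<And>x. P x \<Longrightarrow> \<exists>y. Q y \<and> R x y" "\<And>y. Q y \<Longrightarrow> \<exists>x. P x \<and> R x y"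
    and "\<And>x y y'. P x \<Longrightarrow> Q y \<Longrightarrow> Q y' \<Longrightarrow> R x y \<Longrightarrow> R x y' \<Longrightarrow> y = y'"
    and "\<And>x x' y. P x \<Longrightarrow> P x' \<Longrightarrow> Q y \<Longrightarrow> R x y \<Longrightarrow> R x' y \<Longrightarrow> x = x'"
  shows "(\<exists>!x. P x) \<longleftrightarrow> (\<exists>!y. Q y)"
  using assms by metis

text \<open>The increasing list \<open>js\<close> is determined by the set of occurring weights, and
  injectivity of \<open>a\<close> recovers \<open>is\<close> from the coefficients; so tuples and
  functions correspond one to one.\<close>

lemma ex1_is_representation_iff:
  assumes lam: "strict_mono_on {1..} lam" and a: "strict_mono_on {1..} a" "1 \<le> a 1" and "1 \<le> n"
  shows "(\<exists>!r. case r of (k, is, js) \<Rightarrow> is_representation lam a n k is js) \<longleftrightarrow>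
    (\<exists>!f. weighted_rep (lam ` {1..}) (insert 0 (a ` {1..})) n f)"
proof -
  let ?rep = "\<lambda>(k, is, js). is_representation lam a n k is js"
  let ?wrep = "weighted_rep (lam ` {1..}) (insert 0 (a ` {1..})) n"
  let ?rel = "\<lambda>(k :: nat, is, js) f. {l. f l \<noteq> 0} = lam ` set js \<and>
    (\<forall>h<length js. f (lam (js ! h)) = a (is ! h))"
  have inj_lam: "inj_on lam {1..}" and inj_a: "inj_on a {1..}"
    using lam a strict_mono_on_imp_inj_on by blast+
  have a_pos: "a i \<noteq> 0" if "1 \<le> i" for i
    using a that strict_mono_onD[OF a(1), of 1 i] by (cases "i = 1") auto
  have sum_eq: "(\<Sum>l\<in>lam ` set js. l * f l) = (\<Sum>h=1..length js. lam (js ! (h - 1)) * a (is ! (h - 1)))"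
    if "distinct js" "set js \<subseteq> {1..}" "\<forall>h<length js. f (lam (js ! h)) = a (is ! h)" for js "is" f
  proof -
    have "(\<Sum>l\<in>lam ` set js. l * f l) = (\<Sum>j\<in>set js. lam j * f (lam j))"
      using inj_on_subset[OF inj_lam that(2)] by (simp add: sum.reindex)
    also have "\<dots> = (\<Sum>h<length js. lam (js ! h) * f (lam (js ! h)))"
      using that(1) by (intro sum.reindex_bij_betw[symmetric] bij_betw_nth) simp_all
    also have "\<dots> = (\<Sum>h<length js. lam (js ! h) * a (is ! h))"
      using that(3) by simp
    also have "\<dots> = (\<Sum>h=1..length js. lam (js ! (h - 1)) * a (is ! (h - 1)))"
      by (simp add: sum.atLeast1_atMost_eq)
    finally show ?thesis .
  qed
  show ?thesis
  proof (rule ex1_transfer[where R = ?rel])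
    fix r assume "?rep r"
    then obtain k "is" js where r: "r = (k, is, js)" and rep: "is_representation lam a n k is js"
      by (cases r) auto
    have js: "distinct js" "set js \<subseteq> {1..}" and len: "length is = length js" "k = length js"
      and "is": "\<And>h. h < length js \<Longrightarrow> 1 \<le> is ! h"
      using rep by (auto simp: is_representation_def strict_sorted_iff)
    \<comment> \<open>\<open>THE\<close> inverts the map from \<open>h\<close> to
      \<open>lam (js ! h)\<close>, which is injective as \<open>js\<close> is distinct and
      \<open>lam\<close> is injective on positive indices.\<close>
    define f where "f l = (if l \<in> lam ` set js
      then a (is ! (THE h. h < length js \<and> lam (js ! h) = l)) else 0)" for l
    have nth: "f (lam (js ! h)) = a (is ! h)" if "h < length js" for h
    proof -
      have "(THE h'. h' < length js \<and> lam (js ! h') = lam (js ! h)) = h"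
      proof (rule the_equality)
        fix h' assume h': "h' < length js \<and> lam (js ! h') = lam (js ! h)"
        moreover have "js ! h' \<in> {1..}" "js ! h \<in> {1..}" using js(2) that h' nth_mem by blast+
        ultimately have "js ! h' = js ! h" using inj_onD[OF inj_lam] by blast
        then show "h' = h" using js(1) that h' by (simp add: nth_eq_iff_index_eq)
      qed (use that in simp)
      then show ?thesis using that by (simp add: f_def)
    qed
    have nonzero: "f l \<noteq> 0 \<and> f l \<in> a ` {1..}" if l: "l \<in> lam ` set js" for l
    proof -
      obtain h where "h < length js" "l = lam (js ! h)"
        using l by (metis imageE in_set_conv_nth)
      then show ?thesis using nth "is" a_pos by simp
    qed
    have supp: "{l. f l \<noteq> 0} = lam ` set js"
      using nonzero by (auto simp: f_def)
    have "?wrep f"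
    proof (rule weighted_repI[of "lam ` set js"])
      show "n = (\<Sum>l\<in>lam ` set js. l * f l)"
        using sum_eq[of js f "is"] js nth rep len by (simp add: is_representation_def)
    qed (use supp nonzero js(2) in auto)
    then show "\<exists>f. ?wrep f \<and> ?rel r f"
      using supp nth r by auto
  next
    fix f assume f: "?wrep f"
    have fin: "finite {l. f l \<noteq> 0}" and supp: "{l. f l \<noteq> 0} \<subseteq> lam ` {1..}"
      and val: "n = (\<Sum>l | f l \<noteq> 0. l * f l)"
      using f unfolding weighted_rep_def by blast+
    define J where "J = {j \<in> {1..}. f (lam j) \<noteq> 0}"
    have J: "lam ` J = {l. f l \<noteq> 0}" using supp by (auto simp: J_def)
    have "J \<subseteq> {1..}" by (auto simp: J_def)
    then have "finite J"
      using fin inj_on_subset[OF inj_lam] unfolding J[symmetric] by (blast intro: finite_imageD)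
    define js where "js = sorted_list_of_set J"
    define "is" where "is = map (\<lambda>j. SOME i. 1 \<le> i \<and> a i = f (lam j)) js"
    have js: "set js = J" "distinct js" "sorted_wrt (<) js"
      using \<open>finite J\<close> by (simp_all add: js_def)
    have "is": "1 \<le> is ! h \<and> a (is ! h) = f (lam (js ! h))" if "h < length js" for h
    proof -
      have "js ! h \<in> J" using js(1) that nth_mem by blast
      then have "f (lam (js ! h)) \<in> a ` {1..}"
        using weighted_rep_in_B[OF f, of "lam (js ! h)"] by (simp add: J_def)
      then have "\<exists>i. 1 \<le> i \<and> a i = f (lam (js ! h))" by auto
      from someI_ex[OF this] show ?thesis using that by (simp add: is_def)
    qed
    have len: "length is = length js" by (simp add: is_def)
    \<comment> \<open>Here \<open>1 \<le> n\<close> enters: it yields the requirement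
      \<open>k \<ge> 1\<close>.\<close>
    have "js \<noteq> []"
    proof
      assume "js = []"
      then have "{l. f l \<noteq> 0} = {}" using js(1) J by simp
      then have "n = 0" unfolding val by (simp only: sum.empty)
      then show False using assms(4) by simp
    qed
    have "n = (\<Sum>h=1..length js. lam (js ! (h - 1)) * a (is ! (h - 1)))"
    proof -
      have "(\<Sum>l\<in>lam ` set js. l * f l) = (\<Sum>h=1..length js. lam (js ! (h - 1)) * a (is ! (h - 1)))"
        using js(1,2) \<open>J \<subseteq> {1..}\<close> "is" by (intro sum_eq) simp_all
      then show ?thesis unfolding js(1) J val .
    qed
    moreover have "\<forall>i\<in>set is. 1 \<le> i"
      using "is" len by (metis in_set_conv_nth)
    moreover have "\<forall>j\<in>set js. 1 \<le> j" using js(1) by (simp add: J_def)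
    ultimately have "is_representation lam a n (length js) is js"
      using js(3) len \<open>js \<noteq> []\<close> by (simp add: is_representation_def Suc_le_eq)
    moreover have "?rel (length js, is, js) f"
      using "is" js(1) J by simp
    ultimately show "\<exists>r. ?rep r \<and> ?rel r f" by (intro exI[of _ "(length js, is, js)"]) simp
  next
    fix r f g assume "?rel r f" "?rel r g"
    then obtain k "is" js where supp: "{l. f l \<noteq> 0} = lam ` set js" "{l. g l \<noteq> 0} = lam ` set js"
      and nth: "\<forall>h<length js. f (lam (js ! h)) = g (lam (js ! h))"
      by (cases r) auto
    from nth have same: "\<forall>j\<in>set js. f (lam j) = g (lam j)" by (metis in_set_conv_nth)
    show "f = g"
    proof
      fix l
      show "f l = g l"
      proof (cases "l \<in> lam ` set js")
        case True
        then show ?thesis using same by blast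
      next
        case False
        then have "l \<notin> {l. f l \<noteq> 0}" "l \<notin> {l. g l \<noteq> 0}" unfolding supp by assumption+
        then show ?thesis by simp
      qed
    qed
  next
    fix r r' f assume rep: "?rep r" "?rep r'" and rel: "?rel r f" "?rel r' f"
    obtain k "is" js where r: "r = (k, is, js)" by (cases r)
    obtain k' is' js' where r': "r' = (k', is', js')" by (cases r')
    have js: "sorted_wrt (<) js" "sorted_wrt (<) js'" "set js \<subseteq> {1..}" "set js' \<subseteq> {1..}"
      and len: "length is = length js" "length is' = length js'" "k = length js" "k' = length js'"
      and pos: "\<And>h. h < length js \<Longrightarrow> is ! h \<in> {1..}" "\<And>h. h < length js' \<Longrightarrow> is' ! h \<in> {1..}"
      using rep unfolding r r' by (auto simp: is_representation_def)
    have "lam ` set js = lam ` set js'"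
      using rel unfolding r r' by simp
    then have "set js = set js'"
      using inj_on_image_eq_iff[OF inj_lam js(3,4)] by simp
    then have eq: "js = js'"
      using js(1,2) by (simp add: strict_sorted_equal)
    have "is = is'"
    proof (rule nth_equalityI)
      fix h assume "h < length is"
      then have "h < length js" "h < length js'" using len eq by simp_all
      moreover have "a (is ! h) = a (is' ! h)"
        using rel calculation unfolding r r' eq by simp
      ultimately show "is ! h = is' ! h"
        using inj_onD[OF inj_a] pos by blast
    qed (use len eq in simp)
    then show "r = r'" using r r' eq len by simp
  qed
qed

section \<open>Equivalence of unique representability and the explicit form\<close>

theorem theorem1p3:
  fixes Lam A :: "nat set" and lam a :: "nat \<Rightarrow> nat"
  assumes "infinite Lam" and "Lam = lam ` {1..}" and "1 \<le> lam 1" and "strict_mono_on {1..} lam"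
    and "infinite A" and "A = a ` {1..}" and "1 \<le> a 1" and "strict_mono_on {1..} a"
  shows "(\<forall>n\<ge>1. \<exists>!r. case r of (k, is, js) \<Rightarrow> is_representation lam a n k is js) \<longleftrightarrow>
    (\<exists>b\<ge>2. \<exists>u v. (\<forall>i\<ge>1. u i \<ge> 2 \<and> v i \<ge> 2) \<and>
       Lam = Lambda_set b u v \<and> A = A_set b u v - {0})"
proof -
  have positive: "0 \<notin> f ` {1..}" if "strict_mono_on {1..} f" "1 \<le> f 1" for f :: "nat \<Rightarrow> nat"
  proof
    assume "0 \<in> f ` {1..}"
    then obtain i where "1 \<le> i" "f i = 0" by auto
    then show False using that strict_mono_onD[OF that(1), of 1 i] by (cases "i = 1") auto
  qed
  have zero: "0 \<notin> Lam" "0 \<notin> A"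
    using positive assms(2-4,6-8) by simp_all
  \<comment> \<open>Condition (a) speaks only of \<open>n \<ge> 1\<close>. At \<open>n = 0\<close>
    the zero function is always the only representation, which allows the passage to all
    \<open>n\<close>.\<close>
  have rep_0: "\<exists>!f. weighted_rep Lam (insert 0 A) 0 f"
  proof
    show "weighted_rep Lam (insert 0 A) 0 (\<lambda>_. 0)" by (simp add: weighted_rep_def)
    show "f = (\<lambda>_. 0)" if "weighted_rep Lam (insert 0 A) 0 f" for f
      using weighted_rep_le_coeff[OF that zero(1)] by auto
  qed
  have rep_pos: "(\<exists>!r. case r of (k, is, js) \<Rightarrow> is_representation lam a n k is js) \<longleftrightarrow>
      (\<exists>!f. weighted_rep Lam (insert 0 A) n f)" if "1 \<le> n" for n
    unfolding assms(2,6) using assms(4,8,7) that by (rule ex1_is_representation_iff)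
  have "(\<forall>n\<ge>1. \<exists>!r. case r of (k, is, js) \<Rightarrow> is_representation lam a n k is js) \<longleftrightarrow>
      (\<forall>n\<ge>1. \<exists>!f. weighted_rep Lam (insert 0 A) n f)"
    by (simp only: rep_pos cong: imp_cong)
  also have "\<dots> \<longleftrightarrow> (\<forall>n. \<exists>!f. weighted_rep Lam (insert 0 A) n f)"
  proof (intro iffI allI impI)
    fix n assume rep: "\<forall>n\<ge>1. \<exists>!f. weighted_rep Lam (insert 0 A) n f"
    show "\<exists>!f. weighted_rep Lam (insert 0 A) n f"
    proof (cases "n = 0")
      case True
      show ?thesis unfolding True by (rule rep_0)
    next
      case False
      then have "1 \<le> n" by simp
      then show ?thesis using rep by (elim allE impE)
    qed
  qed (elim allE)
  also have "\<dots> \<longleftrightarrow> (\<exists>b\<ge>2. \<exists>u v. (\<forall>i\<ge>1. u i \<ge> 2 \<and> v i \<ge> 2) \<and>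
       Lam = Lambda_set b u v \<and> A = A_set b u v - {0})"
  proof
    assume "\<forall>n. \<exists>!f. weighted_rep Lam (insert 0 A) n f"
    then interpret unique_weighted_rep Lam "insert 0 A"
      using zero(1) assms(1,5) by unfold_locales simp_all
    have "splitting (weight_exponents, coeff_exponents)"
      using complementing_exponents one_in_weight_exponents infinite_weight_exponents
        infinite_coeff_exponents by (simp add: splitting_def)
    then obtain u v where uv: "\<forall>i\<ge>1. 2 \<le> u i \<and> 2 \<le> v i"
      "weight_exponents = S_inf u v" "coeff_exponents = T_inf u v"
      by (rule splitting_classification)
    have "Lam = Lambda_set base u v"
      using L_eq_powers uv(2) unfolding Lambda_set_def by blast
    moreover have "A = A_set base u v - {0}"
      using B_eq_digits_in uv(3) zero(2) unfolding A_set_eq_digits_in[OF base_ge_2] by auto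
    ultimately show "\<exists>b\<ge>2. \<exists>u v. (\<forall>i\<ge>1. u i \<ge> 2 \<and> v i \<ge> 2) \<and>
       Lam = Lambda_set b u v \<and> A = A_set b u v - {0}"
      using base_ge_2 uv(1) by blast
  next
    assume "\<exists>b\<ge>2. \<exists>u v. (\<forall>i\<ge>1. u i \<ge> 2 \<and> v i \<ge> 2) \<and>
       Lam = Lambda_set b u v \<and> A = A_set b u v - {0}"
    then obtain b u v where b: "2 \<le> b" and uv: "\<And>i. 1 \<le> i \<Longrightarrow> 2 \<le> u i \<and> 2 \<le> v i"
      and eq: "Lam = Lambda_set b u v" "A = A_set b u v - {0}" by blast
    have "Lam = (^) b ` S_inf u v"
      unfolding eq(1) Lambda_set_def by blast
    moreover have "insert 0 A = digits_in b (T_inf u v)"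
      unfolding eq(2) A_set_eq_digits_in[OF b] using zero_in_digits_in by blast
    ultimately show "\<forall>n. \<exists>!f. weighted_rep Lam (insert 0 A) n f"
      using ex1_weighted_rep_powers[OF b complementing_S_inf_T_inf] uv by simp
  qed
  finally show ?thesis .
qed

end
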